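(* Let $b,d\in\mathbb{Z}$ and $f(x)=x^4+bx^2+d$. Then $f(x)$ is monogenic with $\mathrm{Gal}(f)\simeq C_4$ if and only if $f(x)$ is one of the three trinomials \[x^4-4x^2+2,\qquad x^4+4x^2+2,\qquad x^4-5x^2+5.\] Moreover, these three trinomials are pairwise distinct, i.e. the quartic fields they generate are pairwise non-isomorphic.
   Context: A monic polynomial $f(x)\in\mathbb{Z}[x]$ of degree $N$ is called monogenic if $f(x)$ is irreducible over $\mathbb{Q}$ and $\{1,\theta,\theta^2,\ldots,\theta^{N-1}\}$ is a basis for the ring of integers of $\mathbb{Q}(\theta)$, where $f(\theta)=0$. $\mathrm{Gal}(f)$ denotes the Galois group over $\mathbb{Q}$ of the splitting field of $f(x)$, and $C_4$ is the cyclic group of order $4$. Two monogenic polynomials $f(x)$ and $g(x)$ with $\mathrm{Gal}\simeq C_4$ are called distinct if $\mathbb{Q}(\alpha)\not\simeq\mathbb{Q}(\theta)$, where $f(\alpha)=0=g(\theta)$. *)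

theory Defs
  imports
    "HOL-Algebra.Algebraic_Closure_Type"
    "HOL-Algebra.Generated_Fields"
    "HOL-Algebra.Elementary_Groups"
    "HOL-Algebra.Bij"
    Complex_Main
begin

text \<open>
  All number fields are taken inside the complex numbers, so that a root of an integer polynomial
  is a complex root and its splitting field is generated over \<open>\<rat>\<close> by all its complex roots.
\<close>

definition int_poly_roots :: "int poly \<Rightarrow> complex set" where
  "int_poly_roots f = {z. poly (map_poly of_int f) z = 0}"

definition adjoin_Rats :: "complex set \<Rightarrow> complex set" where
  "adjoin_Rats S = generate_field (ring_of_type_algebra :: complex ring) (\<rat> \<union> S)"

definition complex_subring :: "complex set \<Rightarrow> complex ring" where
  "complex_subring K = (ring_of_type_algebra :: complex ring)\<lparr>carrier := K\<rparr>"

definition ring_of_integers :: "complex set \<Rightarrow> complex set" where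
  "ring_of_integers K = {x \<in> K. algebraic_int x}"

definition int_scale :: "int \<Rightarrow> complex \<Rightarrow> complex" where
  "int_scale n x = of_int n * x"

lemma module_int_scale: "Modules.module int_scale"
  by unfold_locales (simp_all add: int_scale_def algebra_simps)

definition int_basis :: "complex set \<Rightarrow> complex set \<Rightarrow> bool" where
  "int_basis B M \<longleftrightarrow>
     \<not> Modules.module.dependent int_scale B \<and> Modules.module.span int_scale B = M"

text \<open>
  The condition is imposed for every root \<open>\<theta>\<close>; as \<open>f\<close> is irreducible, all
  choices of the root are conjugate.
\<close>

definition monogenic :: "int poly \<Rightarrow> bool" where
  "monogenic f \<longleftrightarrow>
     lead_coeff f = 1 \<and>
     irreducible (map_poly of_int f :: rat poly) \<and>
     (\<forall>\<theta> \<in> int_poly_roots f.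
        int_basis {\<theta> ^ i | i. i < degree f} (ring_of_integers (adjoin_Rats {\<theta>})))"

text \<open>
  Elements of \<open>Bij L\<close> are extensional, i.e. determined by their values on \<open>L\<close>.
\<close>

definition galois_group :: "int poly \<Rightarrow> (complex \<Rightarrow> complex) monoid" where
  "galois_group f =
     (let L = adjoin_Rats (int_poly_roots f)
      in BijGroup L
           \<lparr>carrier := {\<sigma> \<in> Bij L. \<sigma> \<in> ring_hom (complex_subring L) (complex_subring L) \<and>
                                     (\<forall>q \<in> \<rat>. \<sigma> q = q)}\<rparr>)"

definition generate_nonisomorphic_fields :: "int poly \<Rightarrow> int poly \<Rightarrow> bool" where
  "generate_nonisomorphic_fields f g \<longleftrightarrow>
     (\<forall>\<alpha> \<in> int_poly_roots f. \<forall>\<theta> \<in> int_poly_roots g.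
        \<not> (complex_subring (adjoin_Rats {\<alpha>}) \<simeq> complex_subring (adjoin_Rats {\<theta>})))"

end

theory Submission
  imports Defs "Jordan_Normal_Form.Char_Poly" "HOL-Computational_Algebra.Squarefree"
begin

text \<open>
  Let \<open>\<theta>\<close> be a root of the irreducible polynomial \<open>x\<^sup>4 + b x\<^sup>2 + d\<close> and \<open>\<phi>\<close> a root with
  \<open>\<phi>\<^sup>2 = - b - \<theta>\<^sup>2\<close>. A generator of a cyclic Galois group maps \<open>\<theta>\<close> to \<open>\<plusminus>\<phi>\<close> and its square is the only
  involution, so \<open>\<phi>\<close> lies in \<open>\<rat>(\<theta>)\<close>; then \<open>\<theta> \<phi>\<close> is a square root of \<open>d\<close> in \<open>\<rat>(\<theta>)\<close> that is not
  rational, which forces \<open>d (b\<^sup>2 - 4 d)\<close> to be a square. If the powers of \<open>\<theta>\<close> form an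
  integral basis, then \<open>d\<close> is squarefree, because \<open>n\<^sup>2\<close> dividing \<open>d\<close> makes \<open>(\<theta>\<^sup>3 + b \<theta>) / n\<close>
  integral; hence \<open>b\<^sup>2 - 4 d = d k\<^sup>2\<close>, and integrality of \<open>(2 \<theta>\<^sup>2 + b) / k = \<plusminus>\<surd>d\<close> gives \<open>k\<close>
  dividing 2. Since \<open>d\<close> divides \<open>b\<close>, this leaves \<open>(b, d)\<close> equal to \<open>(\<plusminus>4, 2)\<close> or \<open>(\<plusminus>5, 5)\<close>.

  Conversely, the relative trace and norm over \<open>\<rat>(\<theta>\<^sup>2)\<close> of an algebraic integer of
  \<open>\<rat>(\<theta>)\<close> satisfy congruences modulo 4 that force integral coordinates. The field of
  \<open>x\<^sup>4 + 4 x\<^sup>2 + 2\<close> is not real, and the other two are told apart by \<open>\<surd>5\<close>.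
\<close>

section \<open>Sums and products of algebraic integers\<close>

interpretation int_scale: Modules.module int_scale
  by (rule module_int_scale)

text \<open>The relations say that \<open>v\<close> is a nonzero eigenvector of the integer matrix
  \<open>c\<close> for the eigenvalue \<open>z\<close>, so \<open>z\<close> is a root of its
  characteristic polynomial, which is monic over the integers.\<close>

lemma algebraic_int_if_int_matrix_eigenvector:
  fixes z :: complex and v :: "nat \<Rightarrow> complex" and c :: "nat \<Rightarrow> nat \<Rightarrow> int"
  assumes eq: "\<And>i. i < n \<Longrightarrow> z * v i = (\<Sum>j<n. of_int (c i j) * v j)"
    and nz: "k < n" "v k \<noteq> 0"
  shows "algebraic_int z"
proof -
  define M where "M = mat n n (\<lambda>(i, j). c i j)"
  define A :: "complex mat" where "A = map_mat of_int M"
  have M: "M \<in> carrier_mat n n" and A: "A \<in> carrier_mat n n"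
    by (simp_all add: M_def A_def)
  have "A *\<^sub>v vec n v = z \<cdot>\<^sub>v vec n v"
    by (rule eq_vecI)
      (auto simp: A_def M_def scalar_prod_def eq lessThan_atLeast0 intro!: sum.cong)
  moreover have "vec n v \<noteq> 0\<^sub>v n"
    using nz by (metis index_vec index_zero_vec(1))
  ultimately have "eigenvector A (vec n v) z"
    using A by (simp add: eigenvector_def)
  hence "poly (char_poly A) z = 0"
    using eigenvalue_root_char_poly[OF A] by (auto simp: eigenvalue_def)
  moreover have "char_poly A = map_poly of_int (char_poly M)"
    unfolding A_def by (rule of_int_hom.char_poly_hom[OF M])
  moreover have "lead_coeff (char_poly M) = 1"
    using degree_monic_char_poly[OF M] by simp
  ultimately show ?thesis
    unfolding algebraic_int_altdef_ipoly by metis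
qed

text \<open>Expanding each \<open>z * w\<close> over \<open>B\<close> gives an integer matrix that
  has the enumerated elements of \<open>B\<close> as an eigenvector, nonzero because of
  \<open>b\<close>.\<close>

lemma algebraic_int_if_span_stable:
  assumes fin: "finite B" and nz: "b \<in> B" "b \<noteq> 0"
    and stable: "\<And>w. w \<in> B \<Longrightarrow> z * w \<in> int_scale.span B"
  shows "algebraic_int z"
proof -
  obtain h where h: "bij_betw h {..<card B} B"
    using fin ex_bij_betw_nat_finite by (metis lessThan_atLeast0)
  have hB: "h i \<in> B" if "i < card B" for i
    using h that by (auto simp: bij_betw_def)
  have "\<exists>c. z * h i = (\<Sum>j<card B. of_int (c j) * h j)" if i: "i < card B" for i
  proof -
    obtain u where u: "z * h i = (\<Sum>w\<in>B. int_scale (u w) w)"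
      using stable[OF hB[OF i]] int_scale.span_finite[OF fin] by auto
    have "(\<Sum>w\<in>B. int_scale (u w) w) = (\<Sum>j<card B. int_scale (u (h j)) (h j))"
      by (rule sum.reindex_bij_betw[OF h, symmetric])
    with u show ?thesis
      by (intro exI[of _ "\<lambda>j. u (h j)"]) (simp add: int_scale_def)
  qed
  then obtain c where
    c: "\<And>i. i < card B \<Longrightarrow> z * h i = (\<Sum>j<card B. of_int (c i j) * h j)"
    by metis
  obtain k where "k < card B" "h k = b"
    using h nz(1) unfolding bij_betw_def by (metis imageE lessThan_iff)
  with c nz(2) show ?thesis
    by (intro algebraic_int_if_int_matrix_eigenvector[where v = h and c = c]) auto
qed

text \<open>Multiplying by \<open>x\<close> raises the exponent of \<open>x\<close>; when it reaches
  \<open>degree p\<close>, the monic equation trades the power for lower ones with integer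
  coefficients. The exponents of \<open>y\<close> are merely carried along, so \<open>J\<close> is
  arbitrary.\<close>

lemma power_prod_span_stable:
  fixes x y :: complex and p :: "int poly"
  assumes root: "poly (map_poly of_int p) x = 0" and monic: "lead_coeff p = 1"
    and w: "w \<in> int_scale.span ((\<lambda>(i, j). x ^ i * y ^ j) ` ({..<degree p} \<times> J))"
  shows "x * w \<in> int_scale.span ((\<lambda>(i, j). x ^ i * y ^ j) ` ({..<degree p} \<times> J))"
    (is "_ \<in> int_scale.span ?B")
  using w
proof (induction rule: int_scale.span_induct_alt)
  case base
  show ?case by (simp add: int_scale.span_zero)
next
  case (step a b w)
  have base: "x ^ i * y ^ j \<in> int_scale.span ?B" if "i < degree p" "j \<in> J" for i j
    using that by (intro int_scale.span_base) force
  from step(1) obtain i j where ij: "i < degree p" "j \<in> J" "b = x ^ i * y ^ j"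
    by auto
  have "x * b \<in> int_scale.span ?B"
  proof (cases "Suc i < degree p")
    case True
    thus ?thesis using base[of "Suc i" j] ij by (simp add: mult_ac)
  next
    case False
    hence deg: "degree p = Suc i" using ij by simp
    have "(\<Sum>k\<le>degree p. of_int (coeff p k) * x ^ k) = 0"
      using root by (simp add: poly_altdef)
    hence "x ^ degree p = - (\<Sum>k<degree p. of_int (coeff p k) * x ^ k)"
      using monic by (simp add: lessThan_Suc_atMost[symmetric] add_eq_0_iff2)
    hence "x * b = (- (\<Sum>k<degree p. of_int (coeff p k) * x ^ k)) * y ^ j"
      using ij deg by (simp add: mult_ac)
    also have "\<dots> = (\<Sum>k<degree p. int_scale (- coeff p k) (x ^ k * y ^ j))"
      by (simp add: int_scale_def sum_distrib_left sum_negf mult_ac)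
    also have "\<dots> \<in> int_scale.span ?B"
      using base ij by (intro int_scale.span_sum int_scale.span_scale) auto
    finally show ?thesis .
  qed
  moreover have "x * (int_scale a b + w) = int_scale a (x * b) + x * w"
    by (simp add: int_scale_def algebra_simps)
  ultimately show ?case
    using step by (simp add: int_scale.span_add int_scale.span_scale)
qed

text \<open>The products of bounded powers of \<open>x\<close> and \<open>y\<close> span a group
  stable under multiplication by both numbers, hence also by their sum and product.\<close>

lemma
  fixes x y :: complex
  assumes "algebraic_int x" "algebraic_int y"
  shows algebraic_int_add: "algebraic_int (x + y)"
    and algebraic_int_mult: "algebraic_int (x * y)"
proof -
  obtain p where p: "poly (map_poly of_int p) x = 0" "lead_coeff p = 1"
    using assms(1) by (auto simp: algebraic_int_altdef_ipoly)
  obtain q where q: "poly (map_poly of_int q) y = 0" "lead_coeff q = 1"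
    using assms(2) by (auto simp: algebraic_int_altdef_ipoly)
  \<comment> \<open>A monic constant is 1 and has no root. Positive degrees put \<open>1\<close>, as
    the product of the zeroth powers, into \<open>B\<close>, where it serves as the nonzero
    element.\<close>
  have pos: "degree r > 0" if "poly (map_poly of_int r) u = 0" "lead_coeff r = 1"
    for r and u :: complex
  proof (rule ccontr)
    assume "\<not> degree r > 0"
    then obtain a where "r = [:a:]" by (auto elim: degree_eq_zeroE)
    with that show False by (auto simp: map_poly_pCons)
  qed
  define B where "B = (\<lambda>(i, j). x ^ i * y ^ j) ` ({..<degree p} \<times> {..<degree q})"
  \<comment> \<open>The set is symmetric in \<open>x\<close> and \<open>y\<close>, so the stability
    lemma applies to \<open>y\<close> as well.\<close>
  have B': "B = (\<lambda>(i, j). y ^ i * x ^ j) ` ({..<degree q} \<times> {..<degree p})"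
    by (force simp: B_def image_iff mult.commute)
  have X: "x * w \<in> int_scale.span B" if "w \<in> int_scale.span B" for w
    using power_prod_span_stable[OF p] that unfolding B_def by blast
  have Y: "y * w \<in> int_scale.span B" if "w \<in> int_scale.span B" for w
    using power_prod_span_stable[OF q] that unfolding B' by blast
  have fin: "finite B" by (simp add: B_def)
  have one: "1 \<in> B"
    using pos[OF p] pos[OF q] by (force simp: B_def image_iff)
  show "algebraic_int (x + y)"
    using X Y by (intro algebraic_int_if_span_stable[OF fin one])
      (auto simp: ring_distribs int_scale.span_base int_scale.span_add)
  show "algebraic_int (x * y)"
    using X Y by (intro algebraic_int_if_span_stable[OF fin one])
      (auto simp: mult.assoc int_scale.span_base)
qed

lemma algebraic_int_diff:
  fixes x y :: complex
  assumes "algebraic_int x" "algebraic_int y"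
  shows "algebraic_int (x - y)"
  using algebraic_int_add[of x "- y"] assms by simp

section \<open>Fields generated over the rationals\<close>

interpretation of_rat_poly: map_poly_comm_ring_hom "of_rat :: rat \<Rightarrow> complex" ..

abbreviation rpoly :: "rat poly \<Rightarrow> complex \<Rightarrow> complex" where
  "rpoly p z \<equiv> poly (map_poly of_rat p) z"

lemma rpoly_add: "rpoly (p + q) z = rpoly p z + rpoly q z"
  by (simp add: hom_distribs)

lemma rpoly_mult: "rpoly (p * q) z = rpoly p z * rpoly q z"
  by (simp add: hom_distribs)

lemma rpoly_pcompose: "rpoly (p \<circ>\<^sub>p q) z = rpoly p (rpoly q z)"
  by (simp add: hom_distribs poly_pcompose)

text \<open>If \<open>p\<close> does not divide \<open>q\<close>, irreducibility makes them coprime,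
  and a Bezout identity evaluated at \<open>z\<close> would read 0 = 1.\<close>

lemma rpoly_0_iff_dvd:
  assumes "irreducible p" "rpoly p z = 0"
  shows "rpoly q z = 0 \<longleftrightarrow> p dvd q"
proof
  assume "rpoly q z = 0"
  show "p dvd q"
  proof (rule ccontr)
    assume "\<not> p dvd q"
    hence "coprime p q"
      using assms(1) by (simp add: irreducible_imp_prime_elem prime_elem_imp_coprime)
    then obtain u v where "u * p + v * q = 1"
      using bezout_coefficients_fst_snd by (metis coprime_imp_gcd_eq_1)
    hence "rpoly (u * p + v * q) z = rpoly 1 z" by simp
    with \<open>rpoly q z = 0\<close> assms(2) show False
      by (simp add: hom_distribs)
  qed
qed (use assms in \<open>auto simp: rpoly_mult elim!: dvdE\<close>)

text \<open>Closure conditions in the operations of the complex type, which spare the proofs the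
  record operations behind \<open>adjoin_Rats\<close>. Since \<open>inverse 0 = 0\<close>, the
  clause for inverses can range over all of \<open>K\<close>.\<close>

definition complex_subfield :: "complex set \<Rightarrow> bool" where
  "complex_subfield K \<longleftrightarrow>
     \<rat> \<subseteq> K \<and> (\<forall>x\<in>K. \<forall>y\<in>K. x + y \<in> K \<and> x * y \<in> K) \<and> (\<forall>x\<in>K. - x \<in> K \<and> inverse x \<in> K)"

lemma complex_subfieldD:
  assumes "complex_subfield K"
  shows "x \<in> \<rat> \<Longrightarrow> x \<in> K" "x \<in> K \<Longrightarrow> y \<in> K \<Longrightarrow> x + y \<in> K" "x \<in> K \<Longrightarrow> y \<in> K \<Longrightarrow> x * y \<in> K"
    "x \<in> K \<Longrightarrow> - x \<in> K" "x \<in> K \<Longrightarrow> inverse x \<in> K" "x \<in> K \<Longrightarrow> y \<in> K \<Longrightarrow> x - y \<in> K"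
    "x \<in> K \<Longrightarrow> x ^ n \<in> K" "x \<in> K \<Longrightarrow> y \<in> K \<Longrightarrow> x / y \<in> K"
proof -
  show 1: "x \<in> \<rat> \<Longrightarrow> x \<in> K" "x \<in> K \<Longrightarrow> y \<in> K \<Longrightarrow> x + y \<in> K" "x \<in> K \<Longrightarrow> y \<in> K \<Longrightarrow> x * y \<in> K"
    "x \<in> K \<Longrightarrow> - x \<in> K" "x \<in> K \<Longrightarrow> inverse x \<in> K" for x y
    using assms by (auto simp: complex_subfield_def)
  show "x \<in> K \<Longrightarrow> y \<in> K \<Longrightarrow> x - y \<in> K"
    using 1(2)[of x "- y"] 1(4) by simp
  show "x \<in> K \<Longrightarrow> y \<in> K \<Longrightarrow> x / y \<in> K"
    using 1(3)[of x "inverse y"] 1(5) by (simp add: divide_inverse)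
  show "x \<in> K \<Longrightarrow> x ^ n \<in> K"
    by (induction n) (use 1 in auto)
qed

lemma ring_of_type_algebra_simps [simp]:
  "carrier (ring_of_type_algebra :: complex ring) = UNIV"
  "x \<otimes>\<^bsub>(ring_of_type_algebra :: complex ring)\<^esub> y = x * y"
  "x \<oplus>\<^bsub>(ring_of_type_algebra :: complex ring)\<^esub> y = x + y"
  "\<one>\<^bsub>(ring_of_type_algebra :: complex ring)\<^esub> = 1"
  "\<zero>\<^bsub>(ring_of_type_algebra :: complex ring)\<^esub> = 0"
  by (simp_all add: ring_of_type_algebra_def)

lemma a_inv_ring_of_type_algebra [simp]:
  "\<ominus>\<^bsub>(ring_of_type_algebra :: complex ring)\<^esub> x = - x"
proof -
  interpret cring "ring_of_type_algebra :: complex ring" ..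
  show ?thesis
    using minus_equality[of "- x" x] by simp
qed

lemma m_inv_ring_of_type_algebra [simp]:
  assumes "x \<noteq> 0"
  shows "inv\<^bsub>(ring_of_type_algebra :: complex ring)\<^esub> x = inverse x"
proof -
  interpret cring "ring_of_type_algebra :: complex ring" ..
  show ?thesis
    using comm_inv_char[of x "inverse x"] assms by simp
qed

lemma complex_subfield_adjoin_Rats: "complex_subfield (adjoin_Rats S)"
proof -
  let ?R = "ring_of_type_algebra :: complex ring"
  note I = generate_field.intros[where R = ?R and H = "\<rat> \<union> S", folded adjoin_Rats_def]
  \<comment> \<open>The generated field is closed only under inverses of nonzero elements;
    \<open>inverse 0 = 0\<close> is covered by the rationals.\<close>
  have "inverse x \<in> adjoin_Rats S" if "x \<in> adjoin_Rats S" for x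
    using I(4)[of x] I(2)[of 0] that by (cases "x = 0") auto
  moreover have "- x \<in> adjoin_Rats S" if "x \<in> adjoin_Rats S" for x
    using I(3)[of x] that by simp
  moreover have "x + y \<in> adjoin_Rats S" "x * y \<in> adjoin_Rats S"
    if "x \<in> adjoin_Rats S" "y \<in> adjoin_Rats S" for x y
    using I(5,6)[of x y] that by simp_all
  ultimately show ?thesis
    using I(2) by (auto simp: complex_subfield_def)
qed

lemma adjoin_Rats_incl: "S \<subseteq> adjoin_Rats S"
  unfolding adjoin_Rats_def by (auto intro: generate_field.incl)

lemma adjoin_Rats_least:
  assumes K: "complex_subfield K" and "S \<subseteq> K"
  shows "adjoin_Rats S \<subseteq> K"
proof
  fix x assume "x \<in> adjoin_Rats S"
  hence "x \<in> generate_field (ring_of_type_algebra :: complex ring) (\<rat> \<union> S)"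
    by (simp add: adjoin_Rats_def)
  thus "x \<in> K"
  proof (induction rule: generate_field.induct)
    case one
    show ?case using complex_subfieldD(1)[OF K] by simp
  next
    case (m_inv h)
    hence "h \<noteq> 0" by simp
    with m_inv show ?case using complex_subfieldD(5)[OF K] by simp
  qed (use assms complex_subfieldD[OF K] in auto)
qed

lemma rpoly_in_complex_subfield:
  assumes K: "complex_subfield K" and "z \<in> K"
  shows "rpoly p z \<in> K"
proof (induction p)
  case 0
  show ?case using complex_subfieldD(1)[OF K] by simp
next
  case (pCons a p)
  thus ?case using complex_subfieldD[OF K] assms(2) by (simp add: hom_distribs)
qed

text \<open>The polynomial values at \<open>z\<close> already form a field: for a nonzero value
  \<open>rpoly q z\<close>, the Bezout identity for \<open>p\<close> and \<open>q\<close> evaluated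
  at \<open>z\<close> exhibits the inverse.\<close>

lemma complex_subfield_range_rpoly:
  assumes p: "irreducible p" "rpoly p z = 0"
  shows "complex_subfield (range (\<lambda>q. rpoly q z))"
  unfolding complex_subfield_def
proof (intro conjI ballI subsetI)
  fix x :: complex assume "x \<in> \<rat>"
  then obtain r where "x = of_rat r" by (auto elim: Rats_cases)
  thus "x \<in> range (\<lambda>q. rpoly q z)" by (intro range_eqI[of _ _ "[:r:]"]) (simp add: hom_distribs)
next
  fix x y assume "x \<in> range (\<lambda>q. rpoly q z)" "y \<in> range (\<lambda>q. rpoly q z)"
  then obtain q r where "x = rpoly q z" "y = rpoly r z" by auto
  thus "x + y \<in> range (\<lambda>q. rpoly q z)" "x * y \<in> range (\<lambda>q. rpoly q z)"
    by (auto intro: range_eqI[of _ _ "q + r"] range_eqI[of _ _ "q * r"] simp: rpoly_add rpoly_mult)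
next
  fix x assume "x \<in> range (\<lambda>q. rpoly q z)"
  then obtain q where q: "x = rpoly q z" by auto
  thus "- x \<in> range (\<lambda>q. rpoly q z)"
    by (intro range_eqI[of _ _ "- q"]) (simp add: hom_distribs)
  show "inverse x \<in> range (\<lambda>q. rpoly q z)"
  proof (cases "x = 0")
    case True
    thus ?thesis by (intro range_eqI[of _ _ 0]) simp
  next
    case False
    hence "\<not> p dvd q" using rpoly_0_iff_dvd[OF p] q by simp
    hence "coprime p q"
      using p(1) by (simp add: irreducible_imp_prime_elem prime_elem_imp_coprime)
    then obtain u v where "u * p + v * q = 1"
      using bezout_coefficients_fst_snd by (metis coprime_imp_gcd_eq_1)
    hence "rpoly (u * p + v * q) z = rpoly 1 z" by simp
    hence "rpoly v z * x = 1"
      using p(2) q by (simp add: hom_distribs)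
    thus ?thesis
      by (intro range_eqI[of _ _ v]) (metis inverse_unique mult.commute)
  qed
qed

lemma adjoin_Rats_singleton:
  assumes "irreducible p" "rpoly p z = 0"
  shows "adjoin_Rats {z} = range (\<lambda>q. rpoly q z)"
proof
  have "z \<in> range (\<lambda>q. rpoly q z)"
    by (intro range_eqI[of _ _ "[:0, 1:]"]) (simp add: hom_distribs)
  thus "adjoin_Rats {z} \<subseteq> range (\<lambda>q. rpoly q z)"
    using complex_subfield_range_rpoly[OF assms] by (intro adjoin_Rats_least) auto
  show "range (\<lambda>q. rpoly q z) \<subseteq> adjoin_Rats {z}"
    using adjoin_Rats_incl
    by (auto intro!: rpoly_in_complex_subfield complex_subfield_adjoin_Rats)
qed

text \<open>Equality at a root means that \<open>p\<close> divides \<open>q - r\<close>, whichever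
  root is taken. This makes the substitution of one root for another a well-defined map.\<close>

lemma rpoly_eq_conjugate:
  assumes "irreducible p" "rpoly p z = 0" "rpoly p z' = 0"
  shows "rpoly q z = rpoly r z \<longleftrightarrow> rpoly q z' = rpoly r z'"
proof -
  have "rpoly q w = rpoly r w \<longleftrightarrow> rpoly (q - r) w = 0" for w
    by (simp add: hom_distribs)
  thus ?thesis
    using rpoly_0_iff_dvd[OF assms(1)] assms(2,3) by metis
qed

text \<open>If the monic integer polynomial \<open>h\<close> annihilates the value at
  \<open>z\<close>, the composition of \<open>h\<close> with \<open>q\<close> vanishes at
  \<open>z\<close> and therefore at \<open>z'\<close>.\<close>

lemma algebraic_int_conjugate:
  assumes p: "irreducible p" "rpoly p z = 0" "rpoly p z' = 0"
    and int: "algebraic_int (rpoly q z)"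
  shows "algebraic_int (rpoly q z')"
proof -
  obtain h where h: "poly (map_poly of_int h) (rpoly q z) = 0" "lead_coeff h = 1"
    using int by (auto simp: algebraic_int_altdef_ipoly)
  have *: "map_poly of_rat (map_poly of_int h) = (map_poly of_int h :: complex poly)"
    by (simp add: map_poly_map_poly o_def)
  have "rpoly (map_poly of_int h \<circ>\<^sub>p q) z = rpoly 0 z"
    using h by (simp add: rpoly_pcompose *)
  hence "rpoly (map_poly of_int h \<circ>\<^sub>p q) z' = 0"
    using rpoly_eq_conjugate[OF p] by (metis map_poly_0 poly_0)
  thus ?thesis
    using h by (auto simp: algebraic_int_altdef_ipoly rpoly_pcompose * intro: exI[of _ h])
qed

lemma hom_rpoly:
  assumes K: "complex_subfield K" "x \<in> K"
    and h: "\<And>x y. x \<in> K \<Longrightarrow> y \<in> K \<Longrightarrow> h (x + y) = h x + h y"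
      "\<And>x y. x \<in> K \<Longrightarrow> y \<in> K \<Longrightarrow> h (x * y) = h x * h y" "\<And>q. q \<in> \<rat> \<Longrightarrow> h q = q"
  shows "h (rpoly p x) = rpoly p (h x)"
proof (induction p)
  case 0
  show ?case using h(3)[of 0] by simp
next
  case (pCons a p)
  have "rpoly p x \<in> K" "of_rat a \<in> K"
    using rpoly_in_complex_subfield[OF K] complex_subfieldD(1)[OF K(1)] by auto
  with pCons K show ?case
    by (simp add: hom_distribs h complex_subfieldD(3)[OF K(1)])
qed

text \<open>Additivity and \<open>h 1 = 1\<close> settle the natural numbers and then the integers;
  clearing the denominator settles fractions. It allows abstract ring isomorphisms to be pulled
  through rational polynomials.\<close>

lemma additive_unit_hom_fixes_Rats:
  assumes K: "complex_subfield K"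
    and h: "\<And>x y. x \<in> K \<Longrightarrow> y \<in> K \<Longrightarrow> h (x + y) = h x + h y"
      "\<And>x y. x \<in> K \<Longrightarrow> y \<in> K \<Longrightarrow> h (x * y) = h x * h y" "h 1 = 1"
    and "q \<in> \<rat>"
  shows "h q = (q :: complex)"
proof -
  note Q = complex_subfieldD(1)[OF K]
  have 0: "h 0 = 0" using h(1)[of 0 0] Q by simp
  have nat: "h (of_nat n) = of_nat n" for n
    by (induction n) (simp_all add: 0 h Q)
  have int: "h (of_int n) = of_int n" for n
  proof (cases n)
    case (nonneg m)
    with nat show ?thesis by simp
  next
    case (neg m)
    have "h (of_int n + of_nat (Suc m)) = h (of_int n) + of_nat (Suc m)"
      using h(1)[of "of_int n" "of_nat (Suc m)"] Q nat[of "Suc m"] by (simp del: of_nat_Suc)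
    moreover have "of_int n + of_nat (Suc m) = (0 :: complex)" using neg by simp
    ultimately show ?thesis using 0 by (metis add_eq_0_iff2)
  qed
  obtain r where r: "q = of_rat r" using assms(5) by (auto elim: Rats_cases)
  obtain a c where ac: "quotient_of r = (a, c)" by fastforce
  have c: "c > 0" using quotient_of_denom_pos[OF ac] .
  have "q * of_int c = of_int a"
    using quotient_of_div[OF ac] c by (simp add: r of_rat_divide)
  moreover have "h (q * of_int c) = h q * of_int c"
    using h(2)[of q "of_int c"] int Q assms(5) by simp
  ultimately have "h q * of_int c = q * of_int c" using int by metis
  thus ?thesis using c by (metis mult_right_cancel of_int_eq_0_iff order_less_irrefl)
qed

text \<open>Since \<open>t\<close> lies outside \<open>K\<close>, the coordinates \<open>u\<close>
  and \<open>v\<close> are unique, so sending \<open>u + v * t\<close> to \<open>u - v * t\<close>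
  is well defined. This conjugation later shows that a cyclic splitting field is no larger than
  \<open>\<rat>(\<theta>)\<close>.\<close>

lemma quadratic_extension:
  assumes K: "complex_subfield K" and t: "t * t \<in> K" "t \<notin> K"
  defines "L \<equiv> {u + v * t | u v. u \<in> K \<and> v \<in> K}"
  shows complex_subfield_quadratic_extension: "complex_subfield L"
    and quadratic_conjugation:
      "\<exists>\<tau>. \<tau> \<in> extensional L \<and> bij_betw \<tau> L L \<and> (\<forall>u\<in>K. \<tau> u = u) \<and> \<tau> t = - t \<and>
         (\<forall>x\<in>L. \<forall>y\<in>L. \<tau> (x + y) = \<tau> x + \<tau> y \<and> \<tau> (x * y) = \<tau> x * \<tau> y)"
proof -
  note D = complex_subfieldD[OF K]
  have 01: "0 \<in> K" "1 \<in> K" using D(1) by simp_all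
  have uniq: "u = u' \<and> v = v'"
    if "u + v * t = u' + v' * t" "u \<in> K" "v \<in> K" "u' \<in> K" "v' \<in> K" for u v u' v'
  proof (cases "v = v'")
    case False
    have "(v - v') * t = u' - u" using that(1) by (simp add: algebra_simps)
    hence "t = (u' - u) / (v - v')" using False by (simp add: field_simps)
    moreover have "(u' - u) / (v - v') \<in> K" by (intro D that)
    ultimately show ?thesis using t(2) by simp
  qed (use that in auto)
  have LI: "u + v * t \<in> L" if "u \<in> K" "v \<in> K" for u v
    using that by (auto simp: L_def)
  have mult: "(u + v * t) * (u' + v' * t) = (u * u' + v * v' * (t * t)) + (u * v' + v * u') * t"
    for u v u' v' by (simp add: algebra_simps)
  have KL: "u \<in> L" if "u \<in> K" for u
    using LI[OF that 01(1)] by simp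
  show L: "complex_subfield L"
    unfolding complex_subfield_def
  proof (intro conjI ballI subsetI)
    fix x y assume "x \<in> L" "y \<in> L"
    then obtain u v u' v' where x: "x = u + v * t" "u \<in> K" "v \<in> K"
      and y: "y = u' + v' * t" "u' \<in> K" "v' \<in> K"
      by (auto simp: L_def)
    have "x + y = (u + u') + (v + v') * t" by (simp add: x y algebra_simps)
    moreover have "\<dots> \<in> L" by (intro LI D x y)
    ultimately show "x + y \<in> L" by simp
    show "x * y \<in> L"
      unfolding x(1) y(1) mult by (intro LI D x y t)
  next
    fix x assume "x \<in> L"
    then obtain u v where x: "x = u + v * t" "u \<in> K" "v \<in> K"
      by (auto simp: L_def)
    have "- x = (- u) + (- v) * t" by (simp add: x)
    moreover have "\<dots> \<in> L" by (intro LI D x)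
    ultimately show "- x \<in> L" by simp
    show "inverse x \<in> L"
    proof (cases "x = 0")
      case False
      have "u - v * t \<noteq> 0"
        using uniq[of u "- v" 0 0] False x D(4) 01 by auto
      \<comment> \<open>The norm of \<open>x\<close> lies in \<open>K\<close>; the conjugate divided
        by it is the inverse of \<open>x\<close>.\<close>
      define n where "n = u * u - v * v * (t * t)"
      have n: "n = x * (u - v * t)" by (simp add: n_def x algebra_simps)
      have "n \<noteq> 0" using \<open>u - v * t \<noteq> 0\<close> False by (simp add: n)
      hence "inverse x = (u - v * t) / n"
        using False \<open>u - v * t \<noteq> 0\<close> by (simp add: n field_simps)
      also have "\<dots> = u / n + (- v / n) * t"
        by (simp add: diff_divide_distrib)
      also have "\<dots> \<in> L"
        unfolding n_def by (intro LI D x t)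
      finally show ?thesis .
    qed (use KL 01 in auto)
  qed (use KL D(1) in auto)
  have "\<forall>x\<in>L. \<exists>w. x = fst w + snd w * t \<and> fst w \<in> K \<and> snd w \<in> K"
  proof
    fix x assume "x \<in> L"
    then obtain u v where "x = u + v * t" "u \<in> K" "v \<in> K" by (auto simp: L_def)
    thus "\<exists>w. x = fst w + snd w * t \<and> fst w \<in> K \<and> snd w \<in> K"
      by (intro exI[of _ "(u, v)"]) simp
  qed
  from bchoice[OF this] obtain W
    where W: "\<forall>x\<in>L. x = fst (W x) + snd (W x) * t \<and> fst (W x) \<in> K \<and> snd (W x) \<in> K" ..
  define U V where "U x = fst (W x)" and "V x = snd (W x)" for x
  have UV: "x = U x + V x * t \<and> U x \<in> K \<and> V x \<in> K" if "x \<in> L" for x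
    using W that by (simp add: U_def V_def)
  \<comment> \<open>The restriction to \<open>L\<close> is there because elements of the Galois
    group are extensional.\<close>
  define \<tau> where "\<tau> = restrict (\<lambda>x. U x - V x * t) L"
  have \<tau>: "\<tau> (u + v * t) = u - v * t" if uv: "u \<in> K" "v \<in> K" for u v
  proof -
    have "U (u + v * t) = u \<and> V (u + v * t) = v"
      using uniq UV[OF LI[OF uv]] uv by metis
    thus ?thesis using LI[OF uv] by (simp add: \<tau>_def)
  qed
  have \<tau>L: "\<tau> x \<in> L" and \<tau>\<tau>: "\<tau> (\<tau> x) = x" if "x \<in> L" for x
  proof -
    obtain u v where x: "x = u + v * t" "u \<in> K" "v \<in> K" using \<open>x \<in> L\<close> by (auto simp: L_def)
    show "\<tau> x \<in> L" using LI[of u "- v"] D(4) x by (simp add: \<tau>)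
    show "\<tau> (\<tau> x) = x" using \<tau>[of u "- v"] D(4) x by (simp add: \<tau>)
  qed
  show "\<exists>\<tau>. \<tau> \<in> extensional L \<and> bij_betw \<tau> L L \<and> (\<forall>u\<in>K. \<tau> u = u) \<and> \<tau> t = - t \<and>
         (\<forall>x\<in>L. \<forall>y\<in>L. \<tau> (x + y) = \<tau> x + \<tau> y \<and> \<tau> (x * y) = \<tau> x * \<tau> y)"
  proof (intro exI[of _ \<tau>] conjI ballI)
    show "\<tau> \<in> extensional L" by (simp add: \<tau>_def)
    show "bij_betw \<tau> L L"
      by (rule bij_betw_byWitness[where f' = \<tau>]) (auto simp: \<tau>L \<tau>\<tau>)
    show "\<tau> t = - t" using \<tau>[of 0 1] 01 by simp
    show "\<tau> u = u" if "u \<in> K" for u using \<tau>[of u 0] 01 that by simp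
  next
    fix x y assume "x \<in> L" "y \<in> L"
    then obtain u v u' v' where x: "x = u + v * t" "u \<in> K" "v \<in> K"
      and y: "y = u' + v' * t" "u' \<in> K" "v' \<in> K"
      by (auto simp: L_def)
    have "x + y = (u + u') + (v + v') * t" by (simp add: x y algebra_simps)
    hence \<tau>xy: "\<tau> (x + y) = (u + u') - (v + v') * t"
      using \<tau>[of "u + u'" "v + v'"] D(2) x(2,3) y(2,3) by simp
    have \<tau>x: "\<tau> x = u - v * t" and \<tau>y: "\<tau> y = u' - v' * t"
      using \<tau> x y by simp_all
    show "\<tau> (x + y) = \<tau> x + \<tau> y"
      unfolding \<tau>x \<tau>y \<tau>xy by (simp add: algebra_simps)
    have "\<tau> (x * y) = (u * u' + v * v' * (t * t)) - (u * v' + v * u') * t"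
      unfolding x(1) y(1) mult by (intro \<tau> D x y t)
    also have "\<dots> = \<tau> x * \<tau> y" unfolding \<tau>x \<tau>y by (simp add: algebra_simps)
    finally show "\<tau> (x * y) = \<tau> x * \<tau> y" .
  qed
qed

section \<open>The Galois group\<close>

lemma carrier_galois_group:
  assumes "L = adjoin_Rats (int_poly_roots f)"
  shows "\<sigma> \<in> carrier (galois_group f) \<longleftrightarrow>
    \<sigma> \<in> extensional L \<and> bij_betw \<sigma> L L \<and>
    (\<forall>x\<in>L. \<forall>y\<in>L. \<sigma> (x + y) = \<sigma> x + \<sigma> y \<and> \<sigma> (x * y) = \<sigma> x * \<sigma> y) \<and> (\<forall>q\<in>\<rat>. \<sigma> q = q)"
  by (auto simp: galois_group_def Let_def assms Bij_def complex_subring_def Ring.ring_hom_def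
      bij_betwE)

lemma mult_galois_group:
  assumes "L = adjoin_Rats (int_poly_roots f)"
    and "\<sigma> \<in> carrier (galois_group f)" "\<tau> \<in> carrier (galois_group f)"
  shows "\<sigma> \<otimes>\<^bsub>galois_group f\<^esub> \<tau> = compose L \<sigma> \<tau>"
  using assms by (simp add: galois_group_def Let_def BijGroup_def)

lemma galois_group_mult_closed:
  assumes "\<sigma> \<in> carrier (galois_group f)" "\<tau> \<in> carrier (galois_group f)"
  shows "\<sigma> \<otimes>\<^bsub>galois_group f\<^esub> \<tau> \<in> carrier (galois_group f)"
proof -
  define L where "L = adjoin_Rats (int_poly_roots f)"
  note C = carrier_galois_group[OF L_def]
  have L: "complex_subfield L" by (simp add: L_def complex_subfield_adjoin_Rats)
  note D = complex_subfieldD[OF L]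
  have "bij_betw (compose L \<sigma> \<tau>) L L"
    using assms by (auto simp: C intro: bij_betw_compose)
  moreover have "\<tau> x \<in> L" if "x \<in> L" for x
    using assms(2) that by (auto simp: C bij_betw_def)
  ultimately have "compose L \<sigma> \<tau> \<in> carrier (galois_group f)"
    using assms by (auto simp: C compose_eq D)
  thus ?thesis using mult_galois_group[OF L_def assms] by simp
qed

text \<open>With \<open>k\<close> the inverse of the isomorphism, \<open>g\<close> is
  \<open>k 1\<close> and every automorphism is some \<open>k i\<close>. The powers of
  \<open>g\<close> are spelled out pointwise on \<open>L\<close>, ready to be evaluated at
  roots.\<close>

lemma galois_group_cyclic4E:
  assumes iso: "galois_group f \<cong> integer_mod_group 4"
    and L: "L = adjoin_Rats (int_poly_roots f)"
  obtains g where "g \<in> carrier (galois_group f)" "\<exists>x\<in>L. g (g x) \<noteq> x"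
    "\<And>\<tau>. \<tau> \<in> carrier (galois_group f) \<Longrightarrow>
       (\<forall>x\<in>L. \<tau> x = x) \<or> (\<forall>x\<in>L. \<tau> x = g x) \<or> (\<forall>x\<in>L. \<tau> x = g (g x)) \<or> (\<forall>x\<in>L. \<tau> x = g (g (g x)))"
proof -
  let ?G = "galois_group f"
  note C = carrier_galois_group[OF L]
  obtain h where h: "h \<in> hom ?G (integer_mod_group 4)"
    "bij_betw h (carrier ?G) (carrier (integer_mod_group 4))"
    using iso by (auto simp: is_iso_def iso_def)
  have Z4: "carrier (integer_mod_group 4) = {0, 1, 2, 3}"
    by (auto simp: carrier_integer_mod_group)
  define k where "k = inv_into (carrier ?G) h"
  have kG: "k i \<in> carrier ?G" and hk: "h (k i) = i" if "i \<in> {0, 1, 2, 3}" for i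
    using h(2) that unfolding Z4 k_def bij_betw_def
    by (metis inv_into_into, metis f_inv_into_f)
  have inj: "\<sigma> = \<tau>" if "h \<sigma> = h \<tau>" "\<sigma> \<in> carrier ?G" "\<tau> \<in> carrier ?G" for \<sigma> \<tau>
    using h(2) that by (auto simp: bij_betw_def inj_on_def)
  have kk: "compose L (k i) (k j) = k ((i + j) mod 4)"
    if ij: "i \<in> {0, 1, 2, 3}" "j \<in> {0, 1, 2, 3}" for i j
  proof -
    have ij': "(i + j) mod 4 \<in> {0, 1, 2, 3}" using ij by auto
    have "h (k i \<otimes>\<^bsub>?G\<^esub> k j) = (i + j) mod 4"
      using h(1) kG[OF ij(1)] kG[OF ij(2)] hk ij by (simp add: hom_def)
    hence "k i \<otimes>\<^bsub>?G\<^esub> k j = k ((i + j) mod 4)"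
      using ij ij' kG hk by (intro inj galois_group_mult_closed) auto
    thus ?thesis using mult_galois_group[OF L] kG ij by metis
  qed
  have kk': "k ((i + j) mod 4) x = k i (k j x)"
    if "x \<in> L" "i \<in> {0, 1, 2, 3}" "j \<in> {0, 1, 2, 3}" for i j x
    using kk[OF that(2,3), symmetric] that(1) by (simp add: compose_eq)
  have kL: "k i x \<in> L" if "x \<in> L" "i \<in> {0, 1, 2, 3}" for i x
    using kG[OF that(2)] that(1) by (auto simp: C bij_betw_def)
  \<comment> \<open>\<open>k 0\<close> is idempotent and injective on \<open>L\<close>, hence the
    identity there.\<close>
  have k0: "k 0 x = x" if "x \<in> L" for x
  proof -
    have "k 0 (k 0 x) = k 0 x" using kk'[OF that, of 0 0] by simp
    thus ?thesis
      using kG[of 0] that kL[OF that, of 0] by (auto simp: C bij_betw_def inj_on_def)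
  qed
  have k2: "k 2 x = k 1 (k 1 x)" if "x \<in> L" for x
    using kk'[OF that, of 1 1] by simp
  have k3: "k 3 x = k 1 (k 1 (k 1 x))" if "x \<in> L" for x
    using kk'[OF that, of 1 2] k2[OF that] by simp
  show ?thesis
  proof
    show "k 1 \<in> carrier ?G" by (rule kG) simp
    show "\<exists>x\<in>L. k 1 (k 1 x) \<noteq> x"
    proof (rule ccontr)
      assume "\<not> ?thesis"
      hence "k 2 x = k 0 x" if "x \<in> L" for x using that k0 k2 by simp
      \<comment> \<open>Extensional functions that agree on \<open>L\<close> are equal, so
        \<open>h\<close> would take the values 2 and 0 at the same element.\<close>
      hence "k 2 = k 0"
        using kG[of 0] kG[of 2] by (intro extensionalityI[of _ L]) (auto simp: C)
      thus False using hk[of 0] hk[of 2] by simp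
    qed
    fix \<tau> assume \<tau>: "\<tau> \<in> carrier ?G"
    hence "h \<tau> \<in> {0, 1, 2, 3}" using h(2) unfolding Z4 bij_betw_def by blast
    moreover have "\<tau> = k (h \<tau>)" using calculation \<tau> hk kG by (intro inj) auto
    ultimately show "(\<forall>x\<in>L. \<tau> x = x) \<or> (\<forall>x\<in>L. \<tau> x = k 1 x) \<or> (\<forall>x\<in>L. \<tau> x = k 1 (k 1 x)) \<or>
        (\<forall>x\<in>L. \<tau> x = k 1 (k 1 (k 1 x)))"
      using k0 k2 k3 by (metis empty_iff insertE)
  qed
qed

section \<open>Biquadratic fields\<close>

lemma rpoly_cubic:
  "rpoly [:a0, a1, a2, a3:] z = of_rat a0 + of_rat a1 * z + of_rat a2 * z ^ 2 + of_rat a3 * z ^ 3"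
  by (simp add: hom_distribs algebra_simps power2_eq_square power3_eq_cube)

lemma rpoly_biquadratic:
  "rpoly [:of_int d, 0, of_int b, 0, 1:] z = z ^ 4 + of_int b * z ^ 2 + of_int d"
  by (simp add: hom_distribs algebra_simps power2_eq_square power4_eq_xxxx)

lemma poly_le_cubic_eq:
  assumes "degree q < 4"
  shows "q = [:coeff q 0, coeff q 1, coeff q 2, coeff q 3:]"
proof (rule poly_eqI)
  fix n
  show "coeff q n = coeff [:coeff q 0, coeff q 1, coeff q 2, coeff q 3:] n"
  proof (cases "n < 4")
    case True
    hence "n \<in> {0, 1, 2, 3}" by auto
    thus ?thesis by (auto simp: numeral_2_eq_2 numeral_3_eq_3)
  next
    case False
    then obtain m where "n = Suc (Suc (Suc (Suc m)))"
      using le_Suc_ex[of 4 n] by (auto simp: numeral_eq_Suc)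
    thus ?thesis using assms False by (simp add: coeff_eq_0)
  qed
qed

section \<open>The field generated by a root of an irreducible biquadratic polynomial\<close>

locale biquadratic =
  fixes b d :: int and \<theta> :: complex
  assumes irred: "irreducible [:of_int d, 0, of_int b, 0, 1 :: rat:]"
    and root: "\<theta> ^ 4 + of_int b * \<theta> ^ 2 + of_int d = 0"
begin

abbreviation "minpoly \<equiv> [:of_int d, 0, of_int b, 0, 1 :: rat:]"

lemma rpoly_minpoly: "rpoly minpoly \<theta> = 0"
  using root unfolding rpoly_biquadratic .

text \<open>The difference of the two cubics is divisible by \<open>minpoly\<close> and has degree
  below 4, so it vanishes. This is the independence of 1, \<open>\<theta>\<close>,
  \<open>\<theta>^2\<close>, \<open>\<theta>^3\<close> over the rationals.\<close>

lemma cubic_eq_iff: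
  "rpoly [:a0, a1, a2, a3:] \<theta> = rpoly [:c0, c1, c2, c3:] \<theta> \<longleftrightarrow>
     a0 = c0 \<and> a1 = c1 \<and> a2 = c2 \<and> a3 = c3"
proof
  assume "rpoly [:a0, a1, a2, a3:] \<theta> = rpoly [:c0, c1, c2, c3:] \<theta>"
  hence "rpoly [:a0 - c0, a1 - c1, a2 - c2, a3 - c3:] \<theta> = 0"
    unfolding rpoly_cubic by (simp add: of_rat_diff algebra_simps)
  hence "minpoly dvd [:a0 - c0, a1 - c1, a2 - c2, a3 - c3:]"
    using rpoly_0_iff_dvd[OF irred rpoly_minpoly] by blast
  moreover have "degree [:a0 - c0, a1 - c1, a2 - c2, a3 - c3:] < degree minpoly"
    by simp
  ultimately have "[:a0 - c0, a1 - c1, a2 - c2, a3 - c3:] = 0"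
    using dvd_imp_degree_le by (meson leD)
  thus "a0 = c0 \<and> a1 = c1 \<and> a2 = c2 \<and> a3 = c3" by simp
qed simp

lemma cubic_eq_0_iff: "rpoly [:a0, a1, a2, a3:] \<theta> = 0 \<longleftrightarrow> a0 = 0 \<and> a1 = 0 \<and> a2 = 0 \<and> a3 = 0"
  using cubic_eq_iff[of a0 a1 a2 a3 0 0 0 0] by simp

lemma adjoin_eq_cubics: "adjoin_Rats {\<theta>} = {rpoly [:a0, a1, a2, a3:] \<theta> | a0 a1 a2 a3. True}"
proof -
  have "\<exists>a0 a1 a2 a3. rpoly q \<theta> = rpoly [:a0, a1, a2, a3:] \<theta>" for q
  proof -
    have "degree (q mod minpoly) < 4"
      using degree_mod_less[of minpoly q] by auto
    moreover have "rpoly q \<theta> = rpoly (q mod minpoly) \<theta>"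
      by (metis (no_types, lifting) add_0 div_mult_mod_eq mult_zero_right rpoly_add rpoly_minpoly rpoly_mult)
    ultimately show ?thesis using poly_le_cubic_eq by metis
  qed
  thus ?thesis
    unfolding adjoin_Rats_singleton[OF irred rpoly_minpoly] by blast
qed

lemma adjoin_cubicE:
  assumes "x \<in> adjoin_Rats {\<theta>}"
  obtains a0 a1 a2 a3 where "x = rpoly [:a0, a1, a2, a3:] \<theta>"
  using assms adjoin_eq_cubics by blast

lemma cubic_in_adjoin: "rpoly [:a0, a1, a2, a3:] \<theta> \<in> adjoin_Rats {\<theta>}"
  using adjoin_eq_cubics by blast

lemma gen_nonzero: "\<theta> \<noteq> 0"
  using cubic_eq_0_iff[of 0 1 0 0] unfolding rpoly_cubic by auto

lemma d_nonzero: "d \<noteq> 0"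
proof
  assume "d = 0"
  hence "\<theta> * (\<theta> ^ 3 + of_int b * \<theta>) = 0"
    using root by (simp add: algebra_simps power2_eq_square power3_eq_cube power4_eq_xxxx)
  thus False
    using gen_nonzero cubic_eq_0_iff[of 0 "of_int b" 0 1] unfolding rpoly_cubic
    by (simp add: add.commute)
qed

text \<open>The expression is the value of \<open>x^2 + b x + d\<close> at \<open>- s\<close>. A
  zero would split the quartic at \<open>\<theta>\<close> into two factors quadratic in
  \<open>\<theta>\<close>, neither of which can vanish.\<close>

lemma no_rational_root: "s ^ 2 - of_int b * s + of_int d \<noteq> (0 :: rat)"
proof
  assume "s ^ 2 - of_int b * s + of_int d = 0"
  hence "of_int d = s * (of_int b - s)" by (simp add: algebra_simps power2_eq_square)
  hence "of_rat (of_int d) = (of_rat (s * (of_int b - s)) :: complex)" by (rule arg_cong)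
  hence "of_int d = of_rat s * (of_int b - of_rat s :: complex)"
    by (simp add: of_rat_mult of_rat_diff)
  hence "(\<theta> ^ 2 + of_rat s) * (\<theta> ^ 2 + (of_int b - of_rat s)) = \<theta> ^ 4 + of_int b * \<theta> ^ 2 + of_int d"
    by (simp add: algebra_simps power2_eq_square power4_eq_xxxx)
  hence "(\<theta> ^ 2 + of_rat s) * (\<theta> ^ 2 + (of_int b - of_rat s)) = 0"
    using root by simp
  hence "rpoly [:s, 0, 1, 0:] \<theta> = 0 \<or> rpoly [:of_int b - s, 0, 1, 0:] \<theta> = 0"
    unfolding rpoly_cubic by (auto simp: of_rat_diff add_ac)
  thus False by (simp only: cubic_eq_0_iff) auto
qed

lemma int_basis_powers_iff:
  "int_basis {\<theta> ^ i | i. i < 4} M \<longleftrightarrow>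
     M = {rpoly [:of_int n0, of_int n1, of_int n2, of_int n3:] \<theta> | n0 n1 n2 n3. True}"
proof -
  have set: "{\<theta> ^ i | i. i < 4} = {1, \<theta>, \<theta> ^ 2, \<theta> ^ 3}"
  proof -
    have "{\<theta> ^ i | i. i < 4} = (\<lambda>i. \<theta> ^ i) ` {..<4}" by auto
    also have "{..<4} = {0, 1, 2, 3 :: nat}" by auto
    finally show ?thesis by simp
  qed
  \<comment> \<open>The powers form a set, so their distinctness is what gives a sum over it four
    separate terms.\<close>
  have "\<theta> \<noteq> 1" "\<theta> ^ 2 \<noteq> 1" "\<theta> ^ 3 \<noteq> 1" "\<theta> ^ 2 \<noteq> \<theta>" "\<theta> ^ 3 \<noteq> \<theta>" "\<theta> ^ 3 \<noteq> \<theta> ^ 2"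
    using cubic_eq_iff[of 0 1 0 0 1 0 0 0] cubic_eq_iff[of 0 0 1 0 1 0 0 0]
      cubic_eq_iff[of 0 0 0 1 1 0 0 0] cubic_eq_iff[of 0 0 1 0 0 1 0 0]
      cubic_eq_iff[of 0 0 0 1 0 1 0 0] cubic_eq_iff[of 0 0 0 1 0 0 1 0]
    unfolding rpoly_cubic by simp_all
  note distinct = this this[symmetric]
  have indep: "\<not> int_scale.dependent {1, \<theta>, \<theta> ^ 2, \<theta> ^ 3}"
  proof
    assume "int_scale.dependent {1, \<theta>, \<theta> ^ 2, \<theta> ^ 3}"
    then obtain u where u: "\<exists>v\<in>{1, \<theta>, \<theta> ^ 2, \<theta> ^ 3}. u v \<noteq> 0"
      "(\<Sum>v\<in>{1, \<theta>, \<theta> ^ 2, \<theta> ^ 3}. int_scale (u v) v) = 0"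
      by (subst (asm) int_scale.dependent_finite) auto
    have "rpoly [:of_int (u 1), of_int (u \<theta>), of_int (u (\<theta> ^ 2)), of_int (u (\<theta> ^ 3)):] \<theta> = 0"
      unfolding rpoly_cubic using u(2) distinct by (simp add: int_scale_def add.assoc)
    with u(1) show False by (simp only: cubic_eq_0_iff) auto
  qed
  have span: "x \<in> int_scale.span {1, \<theta>, \<theta> ^ 2, \<theta> ^ 3} \<longleftrightarrow>
      (\<exists>n0 n1 n2 n3. x = rpoly [:of_int n0, of_int n1, of_int n2, of_int n3:] \<theta>)" for x
    unfolding rpoly_cubic by (simp add: int_scale.span_insert int_scale_def algebra_simps)
  have "int_scale.span {1, \<theta>, \<theta> ^ 2, \<theta> ^ 3} =
      {rpoly [:of_int n0, of_int n1, of_int n2, of_int n3:] \<theta> | n0 n1 n2 n3. True}"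
    unfolding set_eq_iff mem_Collect_eq span by blast
  with indep show ?thesis
    unfolding int_basis_def set by metis
qed

lemma cubic_square:
  "rpoly [:p0, p1, p2, p3:] \<theta> ^ 2 =
     rpoly [:p0\<^sup>2 - of_int d * p2\<^sup>2 - 2 * of_int d * p1 * p3 + of_int (b * d) * p3\<^sup>2,
       2 * p0 * p1 - 2 * of_int d * p2 * p3,
       2 * p0 * p2 - of_int b * p2\<^sup>2 + p1\<^sup>2 - 2 * of_int b * p1 * p3 + of_int (b\<^sup>2 - d) * p3\<^sup>2,
       2 * p0 * p3 + 2 * p1 * p2 - 2 * of_int b * p2 * p3:] \<theta>"
proof -
  define q0 q1 q2 q3 :: complex where "q0 = of_rat p0" "q1 = of_rat p1" "q2 = of_rat p2" "q3 = of_rat p3"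
  define B D :: complex where "B = of_int b" "D = of_int d"
  \<comment> \<open>This is division of the square by the quartic: the right-hand side is the
    quotient times the quartic.\<close>
  have "(q0 + q1 * \<theta> + q2 * \<theta>\<^sup>2 + q3 * \<theta> ^ 3)\<^sup>2 -
      (q0\<^sup>2 - D * q2\<^sup>2 - 2 * D * q1 * q3 + B * D * q3\<^sup>2 + (2 * q0 * q1 - 2 * D * q2 * q3) * \<theta> +
        (2 * q0 * q2 - B * q2\<^sup>2 + q1\<^sup>2 - 2 * B * q1 * q3 + (B\<^sup>2 - D) * q3\<^sup>2) * \<theta>\<^sup>2 +
        (2 * q0 * q3 + 2 * q1 * q2 - 2 * B * q2 * q3) * \<theta> ^ 3) =
      (q2\<^sup>2 + 2 * q1 * q3 + 2 * q2 * q3 * \<theta> + q3\<^sup>2 * (\<theta>\<^sup>2 - B)) * (\<theta> ^ 4 + B * \<theta>\<^sup>2 + D)"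
    by (simp add: algebra_simps power2_eq_square power3_eq_cube power4_eq_xxxx)
  also have "\<theta> ^ 4 + B * \<theta>\<^sup>2 + D = 0"
    using root by (simp add: B_D_def)
  finally show ?thesis
    unfolding rpoly_cubic
    by (simp add: of_rat_add of_rat_diff of_rat_mult of_rat_power q0_q1_q2_q3_def B_D_def)
qed

text \<open>If \<open>y\<close> lies in \<open>\<rat>(\<theta>^2)\<close>, which is generated by a
  square root of \<open>b^2 - 4 d\<close>, the second or third alternative results. Any other
  \<open>y\<close> must be \<open>\<theta>\<close> times an element of that subfield, and taking
  norms of its square gives \<open>c^2 = d N^2\<close>, hence the first.\<close>

lemma square_root_in_adjoin:
  assumes y: "y \<in> adjoin_Rats {\<theta>}" "y ^ 2 = of_rat c"
  shows "\<exists>r :: rat. r ^ 2 = of_int d \<or> r ^ 2 = c \<or> r ^ 2 = c * of_int (b\<^sup>2 - 4 * d)"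
proof -
  obtain p0 p1 p2 p3 where p: "y = rpoly [:p0, p1, p2, p3:] \<theta>"
    using adjoin_cubicE[OF y(1)] .
  have "y ^ 2 = rpoly [:c, 0, 0, 0:] \<theta>"
    unfolding rpoly_cubic by (simp add: y)
  hence e: "p0\<^sup>2 - of_int d * p2\<^sup>2 - 2 * of_int d * p1 * p3 + of_int (b * d) * p3\<^sup>2 = c"
      "2 * p0 * p1 - 2 * of_int d * p2 * p3 = 0"
      "2 * p0 * p2 - of_int b * p2\<^sup>2 + p1\<^sup>2 - 2 * of_int b * p1 * p3 + of_int (b\<^sup>2 - d) * p3\<^sup>2 = 0"
      "2 * p0 * p3 + 2 * p1 * p2 - 2 * of_int b * p2 * p3 = 0"
    unfolding p cubic_square cubic_eq_iff by auto
  \<comment> \<open>The norm of \<open>p1 + p3 * \<theta>^2\<close> from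
    \<open>\<rat>(\<theta>^2)\<close> to the rationals.\<close>
  define N where "N = p1\<^sup>2 - of_int b * p1 * p3 + of_int d * p3\<^sup>2"
  show ?thesis
  proof (cases "p1 = 0 \<and> p3 = 0")
    case True
    show ?thesis
    proof (cases "p2 = 0")
      case True
      thus ?thesis using e \<open>p1 = 0 \<and> p3 = 0\<close> by auto
    next
      case False
      have "2 * p0 * p2 = of_int b * p2 * p2" "p0\<^sup>2 - of_int d * p2\<^sup>2 = c"
        using e True by (auto simp: power2_eq_square)
      hence p0: "p0 = of_int b * p2 / 2" and c: "c = p0\<^sup>2 - of_int d * p2\<^sup>2" using False by auto
      have "(of_int (b\<^sup>2 - 4 * d) * p2 / 2) ^ 2 = c * of_int (b\<^sup>2 - 4 * d)"
        unfolding c p0 by (simp add: field_simps power2_eq_square)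
      thus ?thesis by blast
    qed
  next
    case False
    have N: "N \<noteq> 0"
    proof (cases "p3 = 0")
      case False
      have "(p1 / p3) ^ 2 - of_int b * (p1 / p3) + of_int d = N / p3 ^ 2"
        using False by (simp add: N_def field_simps power2_eq_square)
      thus ?thesis using no_rational_root[of "p1 / p3"] by auto
    qed (use False in \<open>auto simp: N_def\<close>)
    \<comment> \<open>The vanishing coefficients of \<open>\<theta>\<close> and
      \<open>\<theta>^3\<close> are a linear system in \<open>p0\<close> and \<open>p2\<close> with
      determinant \<open>N\<close>; this is Cramer's rule for it.\<close>
    have "N * p0 = (p1 - of_int b * p3) * (p0 * p1 - of_int d * p2 * p3)
        + of_int d * p3 * (p0 * p3 + p1 * p2 - of_int b * p2 * p3)"
      "N * p2 = p1 * (p0 * p3 + p1 * p2 - of_int b * p2 * p3)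
        - p3 * (p0 * p1 - of_int d * p2 * p3)"
      by (simp_all add: N_def algebra_simps power2_eq_square)
    moreover have "p0 * p1 - of_int d * p2 * p3 = 0" "p0 * p3 + p1 * p2 - of_int b * p2 * p3 = 0"
      using e(2,4) by linarith+
    ultimately have "N * p0 = 0" "N * p2 = 0" by simp_all
    hence p02: "p0 = 0" "p2 = 0" using N by auto
    have "of_int d * N ^ 2 - c ^ 2 = of_int d * (p1\<^sup>2 - of_int d * p3\<^sup>2) *
        (p1\<^sup>2 - 2 * of_int b * p1 * p3 + of_int (b\<^sup>2 - d) * p3\<^sup>2)"
      unfolding e(1)[symmetric] p02 N_def by (simp add: algebra_simps power2_eq_square)
    also have "p1\<^sup>2 - 2 * of_int b * p1 * p3 + of_int (b\<^sup>2 - d) * p3\<^sup>2 = 0"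
      using e(3) unfolding p02 by simp
    finally have "c ^ 2 = of_int d * N ^ 2" by simp
    hence "(c / N) ^ 2 = of_int d"
      using N by (simp add: power_divide)
    thus ?thesis by blast
  qed
qed

end

lemma int_poly_roots_biquadratic:
  "z \<in> int_poly_roots [:d, 0, b, 0, 1:] \<longleftrightarrow> z ^ 4 + of_int b * z ^ 2 + of_int d = 0"
  by (simp add: int_poly_roots_def map_poly_pCons algebra_simps power2_eq_square power4_eq_xxxx)

lemma map_poly_of_int_biquadratic:
  "map_poly of_int [:d, 0, b, 0, 1:] = [:of_int d, 0, of_int b, 0, 1 :: rat:]"
  by (simp add: map_poly_pCons)

context biquadratic
begin

text \<open>The ring \<open>\<int>[\<theta>]\<close>, written in coordinates.\<close>

definition integral_cubics :: "complex set" where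
  "integral_cubics = {rpoly [:of_int n0, of_int n1, of_int n2, of_int n3:] \<theta> | n0 n1 n2 n3. True}"

lemma cubic_in_integral_cubics_iff:
  "rpoly [:a0, a1, a2, a3:] \<theta> \<in> integral_cubics \<longleftrightarrow> a0 \<in> \<int> \<and> a1 \<in> \<int> \<and> a2 \<in> \<int> \<and> a3 \<in> \<int>"
  unfolding integral_cubics_def mem_Collect_eq cubic_eq_iff by (auto elim!: Ints_cases)

lemma algebraic_int_gen: "algebraic_int \<theta>"
  unfolding algebraic_int_altdef_ipoly
  using root int_poly_roots_biquadratic[of \<theta> d b]
  by (intro exI[of _ "[:d, 0, b, 0, 1:]"]) (simp add: int_poly_roots_def)

end

text \<open>Irreducibility makes the four powers independent, so of the basis condition only the
  equality of the ring of integers with \<open>\<int>[\<theta>]\<close> remains.\<close>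

lemma monogenic_biquadratic_iff:
  "monogenic [:d, 0, b, 0, 1:] \<longleftrightarrow> irreducible [:of_int d, 0, of_int b, 0, 1 :: rat:] \<and>
     (\<forall>z. z ^ 4 + of_int b * z ^ 2 + of_int d = 0 \<longrightarrow>
        ring_of_integers (adjoin_Rats {z}) = biquadratic.integral_cubics z)"
proof -
  have deg: "degree [:d, 0, b, 0, 1:] = 4" and lead: "coeff [:d, 0, b, 0, 1:] 4 = 1"
    by (simp_all add: numeral_eq_Suc)
  have "int_basis {z ^ i | i. i < 4} M \<longleftrightarrow> M = biquadratic.integral_cubics z"
    if "irreducible [:of_int d, 0, of_int b, 0, 1 :: rat:]"
      "z ^ 4 + of_int b * z ^ 2 + of_int d = 0" for z M
  proof -
    interpret biquadratic b d z using that by unfold_locales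
    show ?thesis by (simp only: int_basis_powers_iff integral_cubics_def)
  qed
  thus ?thesis
    unfolding monogenic_def map_poly_of_int_biquadratic Ball_def int_poly_roots_biquadratic deg lead
    by blast
qed

section \<open>Cyclic quartic fields\<close>

lemma inverse_integral_imp_unit:
  fixes n :: int
  assumes "inverse (of_int n :: rat) \<in> \<int>" "n \<noteq> 0"
  shows "n dvd 1"
proof -
  obtain m where "inverse (of_int n :: rat) = of_int m" using assms(1) by (auto elim: Ints_cases)
  hence "of_int (n * m) = (1 :: rat)" using assms(2) by (simp flip: of_int_mult add: field_simps)
  hence "n * m = 1" by (simp only: of_int_eq_1_iff)
  thus ?thesis by (metis dvd_triv_left)
qed

lemma complex_eq_minus_self_imp_0:
  fixes x :: complex
  assumes "x = - x"
  shows "x = 0"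
  using assms by (simp add: complex_eq_iff)

context biquadratic
begin

lemma d_eq_product_of_squares:
  assumes "\<phi>\<^sup>2 = - of_int b - \<theta>\<^sup>2"
  shows "of_int d = \<theta>\<^sup>2 * \<phi>\<^sup>2"
  using root unfolding assms
  by (simp add: algebra_simps power2_eq_square power4_eq_xxxx add_eq_0_iff2)

lemma int_poly_roots_eq:
  assumes \<phi>: "\<phi>\<^sup>2 = - of_int b - \<theta>\<^sup>2"
  shows "int_poly_roots [:d, 0, b, 0, 1:] = {\<theta>, - \<theta>, \<phi>, - \<phi>}"
proof -
  have b: "of_int b = - (\<phi>\<^sup>2) - \<theta>\<^sup>2" using \<phi> by simp
  have "z ^ 4 + of_int b * z\<^sup>2 + of_int d = (z - \<theta>) * (z + \<theta>) * ((z - \<phi>) * (z + \<phi>))" for z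
    unfolding d_eq_product_of_squares[OF \<phi>] b
    by (simp add: algebra_simps power2_eq_square power4_eq_xxxx)
  thus ?thesis
    unfolding set_eq_iff int_poly_roots_biquadratic by (auto simp: eq_neg_iff_add_eq_0)
qed

text \<open>The generator \<open>g\<close> negates \<open>\<theta> * \<phi>\<close>, whose square is
  \<open>d\<close>, so \<open>d\<close> is not a rational square. With \<open>c = d\<close>,
  \<open>square_root_in_adjoin\<close> then leaves only its third alternative.\<close>

lemma cyclic_imp_square:
  assumes cyc: "galois_group [:d, 0, b, 0, 1:] \<cong> integer_mod_group 4"
  shows "\<exists>r :: rat. r ^ 2 = of_int (d * (b\<^sup>2 - 4 * d))"
proof -
  define f where "f = [:d, 0, b, 0, 1:]"
  define \<phi> where "\<phi> = csqrt (- of_int b - \<theta> ^ 2)"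
  define L where "L = adjoin_Rats (int_poly_roots f)"
  define K where "K = adjoin_Rats {\<theta>}"
  have \<phi>2: "\<phi> ^ 2 = - of_int b - \<theta> ^ 2" by (simp add: \<phi>_def)
  note dprod = d_eq_product_of_squares[OF \<phi>2]
  have roots: "int_poly_roots f = {\<theta>, - \<theta>, \<phi>, - \<phi>}"
    unfolding f_def by (rule int_poly_roots_eq[OF \<phi>2])
  have K: "complex_subfield K" and L: "complex_subfield L"
    by (simp_all add: K_def L_def complex_subfield_adjoin_Rats)
  have \<theta>K: "\<theta> \<in> K" using adjoin_Rats_incl[of "{\<theta>}"] by (simp add: K_def)
  have rootsL: "int_poly_roots f \<subseteq> L" unfolding L_def by (rule adjoin_Rats_incl)
  hence \<theta>L: "\<theta> \<in> L" and \<phi>L: "\<phi> \<in> L" by (simp_all add: roots)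
  have KL: "K \<subseteq> L" unfolding K_def using \<theta>L by (intro adjoin_Rats_least L) simp
  note DK = complex_subfieldD[OF K] and DL = complex_subfieldD[OF L]
  note C = carrier_galois_group[OF L_def]
  obtain g where g: "g \<in> carrier (galois_group f)" and gg: "\<exists>x\<in>L. g (g x) \<noteq> x"
    and gen: "\<And>\<tau>. \<tau> \<in> carrier (galois_group f) \<Longrightarrow>
       (\<forall>x\<in>L. \<tau> x = x) \<or> (\<forall>x\<in>L. \<tau> x = g x) \<or> (\<forall>x\<in>L. \<tau> x = g (g x)) \<or> (\<forall>x\<in>L. \<tau> x = g (g (g x)))"
    using galois_group_cyclic4E[OF cyc[folded f_def] L_def] by blast
  have gL: "g x \<in> L" if "x \<in> L" for x using g that by (auto simp: C bij_betw_def)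
  have gadd: "g (x + y) = g x + g y" and gmult: "g (x * y) = g x * g y" if "x \<in> L" "y \<in> L" for x y
    using g that by (auto simp: C)
  have grat: "g q = q" if "q \<in> \<rat>" for q using g that by (auto simp: C)
  have gminus: "g (- x) = - g x" if "x \<in> L" for x
    using gmult[of "-1" x] grat[of "-1"] DL(1)[of "-1"] that by simp
  have ginj: "x = y" if "g x = g y" "x \<in> L" "y \<in> L" for x y
    using g that by (auto simp: C bij_betw_def inj_on_def)
  have groot: "g z \<in> int_poly_roots f" if "z \<in> int_poly_roots f" for z
  proof -
    have "g (rpoly minpoly z) = rpoly minpoly (g z)"
      using that rootsL by (intro hom_rpoly[OF L]) (auto simp: gadd gmult grat)
    thus ?thesis
      using that grat[of 0] unfolding f_def int_poly_roots_biquadratic rpoly_biquadratic by simp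
  qed
  \<comment> \<open>If \<open>g\<close> applied twice fixed both roots, it would fix the field they
    generate, against order 4.\<close>
  have not_involution: "\<not> (g (g \<theta>) = \<theta> \<and> g (g \<phi>) = \<phi>)"
  proof
    assume fixed: "g (g \<theta>) = \<theta> \<and> g (g \<phi>) = \<phi>"
    have ginv: "g (inverse x) = inverse (g x)" if "x \<in> L" for x
    proof (cases "x = 0")
      case False
      have "g x * g (inverse x) = 1"
        using gmult[of x "inverse x"] DL(5) that False grat[of 1] by simp
      thus ?thesis by (metis inverse_unique)
    qed (use grat[of 0] in simp)
    have "complex_subfield {x \<in> L. g (g x) = x}"
      unfolding complex_subfield_def
      by (auto simp: DL grat gadd gmult gminus ginv gL)
    moreover have "int_poly_roots f \<subseteq> {x \<in> L. g (g x) = x}"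
      using fixed \<theta>L \<phi>L by (auto simp: roots gminus gL DL)
    ultimately have "L \<subseteq> {x \<in> L. g (g x) = x}"
      unfolding L_def by (rule adjoin_Rats_least)
    thus False using gg by blast
  qed
  have g4: "g \<theta> = \<phi> \<and> g \<phi> = - \<theta> \<or> g \<theta> = - \<phi> \<and> g \<phi> = \<theta>"
  proof -
    have g\<theta>: "g \<theta> = \<theta> \<or> g \<theta> = - \<theta> \<or> g \<theta> = \<phi> \<or> g \<theta> = - \<phi>"
      and g\<phi>: "g \<phi> = \<theta> \<or> g \<phi> = - \<theta> \<or> g \<phi> = \<phi> \<or> g \<phi> = - \<phi>"
      using groot[of \<theta>] groot[of \<phi>] by (simp_all add: roots)
    have inj: "g \<theta> = g \<phi> \<Longrightarrow> \<theta> = \<phi>" "g \<theta> = - g \<phi> \<Longrightarrow> \<theta> = - \<phi>"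
      using ginj[of \<theta> \<phi>] ginj[of \<theta> "- \<phi>"] \<theta>L \<phi>L by (simp_all add: gminus DL)
    \<comment> \<open>If \<open>g\<close> kept \<open>\<theta>\<close> up to sign, injectivity would
      make it keep \<open>\<phi>\<close> up to sign, and \<open>g\<close> applied twice would fix
      both.\<close>
    have n\<theta>: "g \<theta> \<noteq> \<theta> \<and> g \<theta> \<noteq> - \<theta>"
    proof (rule ccontr)
      assume "\<not> (g \<theta> \<noteq> \<theta> \<and> g \<theta> \<noteq> - \<theta>)"
      hence \<theta>: "g \<theta> = \<theta> \<or> g \<theta> = - \<theta>" by blast
      hence "g (g \<theta>) = \<theta>" using gminus[OF \<theta>L] by (metis minus_minus)
      moreover from this have "g (g \<phi>) = \<phi>"
        using g\<phi> inj \<theta> gminus[OF \<phi>L] by (metis minus_minus)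
      ultimately show False using not_involution by blast
    qed
    hence "g \<theta> = \<phi> \<or> g \<theta> = - \<phi>" using g\<theta> by blast
    moreover have "g \<phi> \<noteq> \<phi> \<and> g \<phi> \<noteq> - \<phi>"
      using n\<theta> inj calculation by (metis minus_minus)
    ultimately show ?thesis
      using not_involution g\<phi> gminus[OF \<theta>L] gminus[OF \<phi>L] by (metis minus_minus)
  qed
  \<comment> \<open>Otherwise \<open>L\<close> is quadratic over \<open>K\<close>, and its
    conjugation fixes \<open>\<theta>\<close> but moves \<open>\<phi>\<close>. Among the powers of
    \<open>g\<close> only the identity fixes \<open>\<theta>\<close>.\<close>
  have \<phi>K: "\<phi> \<in> K"
  proof (rule ccontr)
    assume nK: "\<phi> \<notin> K"
    have "\<phi> * \<phi> \<in> K"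
      using \<phi>2 DK \<theta>K by (simp add: power2_eq_square)
    note Q = quadratic_extension[OF K this nK]
    have L_eq: "{u + v * \<phi> | u v. u \<in> K \<and> v \<in> K} = L" (is "?L = L")
    proof
      show "?L \<subseteq> L" using KL \<phi>L by (auto intro!: DL(2,3))
      have "u \<in> ?L" if "u \<in> K" for u using that DK(1)[of 0] by force
      moreover have "v * \<phi> \<in> ?L" if "v \<in> K" for v using that DK(1)[of 0] by force
      from this[of 1] this[of "-1"] have "\<phi> \<in> ?L" "- \<phi> \<in> ?L" using DK(1) by simp_all
      ultimately have "int_poly_roots f \<subseteq> ?L"
        using \<theta>K DK(4) unfolding roots by blast
      thus "L \<subseteq> ?L" unfolding L_def by (rule adjoin_Rats_least[OF Q(1)])
    qed
    obtain \<tau> where \<tau>: "\<tau> \<in> extensional L" "bij_betw \<tau> L L" "\<forall>u\<in>K. \<tau> u = u" "\<tau> \<phi> = - \<phi>"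
      "\<forall>x\<in>L. \<forall>y\<in>L. \<tau> (x + y) = \<tau> x + \<tau> y \<and> \<tau> (x * y) = \<tau> x * \<tau> y"
      using Q(2) unfolding L_eq by blast
    have "\<tau> \<in> carrier (galois_group f)"
      using \<tau> DK(1) by (simp add: C)
    from gen[OF this] consider "\<tau> \<phi> = \<phi>" | "\<tau> \<theta> = g \<theta>" | "\<tau> \<theta> = g (g \<theta>)" | "\<tau> \<theta> = g (g (g \<theta>))"
      using \<theta>L \<phi>L by blast
    moreover have \<tau>\<theta>: "\<tau> \<theta> = \<theta>" using \<tau>(3) \<theta>K by blast
    have g\<theta>: "g \<theta> \<noteq> \<theta>" "g \<theta> \<noteq> - \<theta>"
      using g4 nK DK(4)[of \<theta>] DK(4)[of "- \<phi>"] \<theta>K by (metis minus_minus)+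
    have gg\<theta>: "g (g \<theta>) = - \<theta>" using g4 gminus[OF \<phi>L] by (metis minus_minus)
    have "\<phi> \<noteq> 0" using nK DK(1)[of 0] by auto
    ultimately show False
    proof cases
      case 1
      with \<open>\<phi> \<noteq> 0\<close> \<tau>(4) complex_eq_minus_self_imp_0[of \<phi>] show False by simp
    next
      case 2
      with \<tau>\<theta> g\<theta> show False by simp
    next
      case 3
      with \<tau>\<theta> gg\<theta> gen_nonzero complex_eq_minus_self_imp_0[of \<theta>] show False by simp
    next
      case 4
      with \<tau>\<theta> gg\<theta> gminus[OF \<theta>L] g\<theta> show False by (metis minus_minus)
    qed
  qed
  have "\<theta> * \<phi> \<in> K" by (intro DK \<theta>K \<phi>K)
  moreover have sq: "(\<theta> * \<phi>) ^ 2 = of_rat (of_int d)"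
    by (simp add: dprod power_mult_distrib)
  ultimately obtain r :: rat where "r ^ 2 = of_int d \<or> r ^ 2 = of_int d * of_int (b\<^sup>2 - 4 * d)"
    using square_root_in_adjoin unfolding K_def by blast
  \<comment> \<open>A rational square root of \<open>d\<close> would make
    \<open>\<theta> * \<phi>\<close> rational and hence fixed by \<open>g\<close>, which negates
    it.\<close>
  moreover have "r ^ 2 \<noteq> of_int d"
  proof
    assume "r ^ 2 = of_int d"
    hence "(\<theta> * \<phi>) ^ 2 = of_rat r ^ 2"
      unfolding sq by (simp flip: of_rat_power)
    hence "\<theta> * \<phi> = of_rat r \<or> \<theta> * \<phi> = - of_rat r" by (simp add: power2_eq_iff)
    hence "\<theta> * \<phi> \<in> \<rat>" by auto
    hence "g (\<theta> * \<phi>) = \<theta> * \<phi>" by (rule grat)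
    moreover have "g (\<theta> * \<phi>) = - (\<theta> * \<phi>)"
      using gmult[OF \<theta>L \<phi>L] g4 by auto
    ultimately have "\<theta> * \<phi> = 0" by (intro complex_eq_minus_self_imp_0) simp
    hence "(\<theta> * \<phi>) ^ 2 = 0" by simp
    thus False unfolding sq using d_nonzero by simp
  qed
  ultimately show ?thesis by (auto simp del: of_int_diff)
qed

section \<open>Consequences of an integral power basis\<close>

context
  assumes integral: "ring_of_integers (adjoin_Rats {\<theta>}) = integral_cubics"
begin

lemma coeffs_integral:
  assumes "algebraic_int (rpoly [:a0, a1, a2, a3:] \<theta>)"
  shows "a0 \<in> \<int> \<and> a1 \<in> \<int> \<and> a2 \<in> \<int> \<and> a3 \<in> \<int>"
  using assms integral cubic_in_adjoin cubic_in_integral_cubics_iff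
  unfolding ring_of_integers_def by blast

text \<open>\<open>Y\<close> is \<open>- d / \<theta>\<close>, and its quartic
  \<open>x^4 + b d x^2 + d^3\<close> is the minimal polynomial reversed and rescaled. Division of
  the root by \<open>n\<close> keeps the coefficients integral because \<open>n^2\<close> divides
  \<open>d\<close>; the coordinate \<open>1 / n\<close> of \<open>y\<close> must then be an
  integer.\<close>

lemma squarefree_d: "squarefree d"
proof (rule squarefreeI)
  fix n assume "n ^ 2 dvd d"
  then obtain e where e: "d = n ^ 2 * e" by auto
  with d_nonzero have n: "n \<noteq> 0" by auto
  define y where "y = rpoly [:0, of_int b / of_int n, 0, 1 / of_int n:] \<theta>"
  define Y where "Y = \<theta> ^ 3 + of_int b * \<theta>"
  have y: "y = Y / of_int n"
    unfolding y_def rpoly_cubic Y_def by (simp add: of_rat_divide add_divide_distrib)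
  have Y\<theta>: "Y * \<theta> = - of_int d"
    using root by (simp add: Y_def algebra_simps power2_eq_square power3_eq_cube power4_eq_xxxx eq_neg_iff_add_eq_0)
  have "\<theta> ^ 4 * (Y ^ 4 + of_int (b * d) * Y ^ 2 + of_int (d ^ 3)) =
      (Y * \<theta>) ^ 4 + of_int (b * d) * \<theta> ^ 2 * (Y * \<theta>) ^ 2 + of_int (d ^ 3) * \<theta> ^ 4"
    by (simp add: algebra_simps power_mult_distrib power2_eq_square power4_eq_xxxx)
  also have "\<dots> = of_int (d ^ 3) * (\<theta> ^ 4 + of_int b * \<theta> ^ 2 + of_int d)"
    unfolding Y\<theta> by (simp add: algebra_simps power2_eq_square power3_eq_cube power4_eq_xxxx)
  also have "\<dots> = 0" using root by simp
  finally have "Y ^ 4 + of_int (b * d) * Y ^ 2 + of_int (d ^ 3) = 0"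
    using gen_nonzero by simp
  hence "of_int n ^ 4 * (y ^ 4 + of_int (b * e) * y ^ 2 + of_int (n\<^sup>2 * e ^ 3)) = 0"
    using n by (simp add: y e field_simps power2_eq_square power3_eq_cube power4_eq_xxxx)
  hence "y ^ 4 + of_int (b * e) * y ^ 2 + of_int (n\<^sup>2 * e ^ 3) = 0"
    using n by simp
  hence "poly (map_poly of_int [:n\<^sup>2 * e ^ 3, 0, b * e, 0, 1:]) y = 0"
    using int_poly_roots_biquadratic[of y "n\<^sup>2 * e ^ 3" "b * e"] by (simp add: int_poly_roots_def)
  hence "algebraic_int y"
    unfolding algebraic_int_altdef_ipoly by (intro exI[of _ "[:n\<^sup>2 * e ^ 3, 0, b * e, 0, 1:]"]) simp
  from coeffs_integral[OF this[unfolded y_def]] have "inverse (of_int n :: rat) \<in> \<int>"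
    by (simp add: inverse_eq_divide)
  thus "n dvd 1" using n by (rule inverse_integral_imp_unit)
qed

text \<open>The element \<open>(2 \<theta>^2 + b) / k\<close> squares to \<open>d\<close>, so it is
  an algebraic integer and its coordinate \<open>2 / k\<close> is an integer.\<close>

lemma conductor_dvd_2:
  assumes k: "b\<^sup>2 - 4 * d = d * k\<^sup>2" "k \<noteq> 0"
  shows "k dvd 2"
proof -
  define y where "y = rpoly [:of_int b / of_int k, 0, 2 / of_int k, 0:] \<theta>"
  have y: "y = (2 * \<theta> ^ 2 + of_int b) / of_int k"
    unfolding y_def rpoly_cubic by (simp add: of_rat_divide add_divide_distrib)
  have "(2 * \<theta> ^ 2 + of_int b) ^ 2 = 4 * (\<theta> ^ 4 + of_int b * \<theta> ^ 2 + of_int d) + of_int (b\<^sup>2 - 4 * d)"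
    by (simp add: algebra_simps power2_eq_square power4_eq_xxxx)
  also have "\<dots> = of_int (d * k\<^sup>2)" unfolding k(1) using root by simp
  finally have "y ^ 2 = of_int d" using k(2) by (simp add: y power_divide)
  hence "algebraic_int y"
    unfolding algebraic_int_altdef_ipoly
    by (intro exI[of _ "[:- d, 0, 1:]"]) (simp add: map_poly_pCons power2_eq_square)
  from coeffs_integral[OF this[unfolded y_def]] obtain m where "2 / of_int k = (of_int m :: rat)"
    by (auto elim: Ints_cases)
  hence "of_int (k * m) = (of_int 2 :: rat)" using k(2) by (simp add: field_simps)
  hence "k * m = 2" by (simp only: of_int_eq_iff)
  thus ?thesis by (metis dvd_triv_left)
qed

text \<open>
  For \<open>b = d = 5\<close> the field is the fifth cyclotomic field, and \<open>(1 + \<theta> + \<theta>\<^sup>2) / 2\<close> is an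
  algebraic integer: with \<open>u = \<theta>\<^sup>2 + 1\<close> it satisfies \<open>y\<^sup>2 = u (y + 1)\<close>.
\<close>

lemma not_5_5: "\<not> (b = 5 \<and> d = 5)"
proof
  assume bd: "b = 5 \<and> d = 5"
  define y where "y = rpoly [:1 / 2, 1 / 2, 1 / 2, 0:] \<theta>"
  have y: "y = (1 + \<theta> + \<theta> ^ 2) / 2"
    unfolding y_def rpoly_cubic by (simp add: of_rat_divide add_divide_distrib)
  have root5: "\<theta> ^ 4 + 5 * \<theta> ^ 2 + 5 = 0" using root bd by simp
  define u where "u = \<theta> ^ 2 + 1"
  have u2: "u ^ 2 = - 3 * u - 1"
    using root5 by (simp add: u_def algebra_simps power2_eq_square power4_eq_xxxx eq_neg_iff_add_eq_0)
  have "4 * (y ^ 2 - u * (y + 1)) = - (\<theta> ^ 4 + 5 * \<theta> ^ 2 + 5)"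
    by (simp add: y u_def field_simps power2_eq_square power4_eq_xxxx)
  hence y2: "y ^ 2 = u * (y + 1)" using root5 by simp
  \<comment> \<open>The quartic is the norm of \<open>y^2 - u (y + 1)\<close>, obtained by
    eliminating \<open>u\<close> with \<open>u^2 + 3 u + 1 = 0\<close>.\<close>
  have "y ^ 4 + 3 * y ^ 3 + 4 * y ^ 2 + 2 * y + 1 = (y ^ 2) ^ 2 + 3 * (y ^ 2) * (y + 1) + (y + 1) ^ 2"
    by (simp add: algebra_simps power2_eq_square power3_eq_cube power4_eq_xxxx)
  also have "\<dots> = (y + 1) ^ 2 * (u ^ 2 + 3 * u + 1)"
    unfolding y2 by (simp add: algebra_simps power2_eq_square)
  also have "\<dots> = 0" using u2 by simp
  finally have "algebraic_int y"
    unfolding algebraic_int_altdef_ipoly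
    by (intro exI[of _ "[:1, 2, 4, 3, 1:]"])
      (simp add: map_poly_pCons algebra_simps power2_eq_square power3_eq_cube power4_eq_xxxx)
  from coeffs_integral[OF this[unfolded y_def]] have "inverse (of_int 2 :: rat) \<in> \<int>"
    by (simp add: inverse_eq_divide)
  from inverse_integral_imp_unit[OF this] show False by simp
qed

end

end

section \<open>The possible coefficients\<close>

lemma rational_square_imp_square:
  fixes r :: rat and n :: int
  assumes "r ^ 2 = of_int n"
  shows "\<exists>m. n = m ^ 2"
proof -
  obtain a c where ac: "quotient_of r = (a, c)" by fastforce
  have c: "c > 0" using quotient_of_denom_pos[OF ac] .
  have "of_int (a ^ 2) = (of_int (n * c ^ 2) :: rat)"
    using assms c unfolding quotient_of_div[OF ac] by (simp add: field_simps)
  hence a2: "a ^ 2 = n * c ^ 2" by (simp only: of_int_eq_iff)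
  hence "c ^ 2 dvd a ^ 2" by simp
  hence "c dvd a" by (simp add: pow_divides_pow_iff)
  hence "c = 1" using quotient_of_coprime[OF ac] c
    by (metis coprime_absorb_right coprime_commute zdvd1_eq abs_of_pos)
  with a2 show ?thesis by auto
qed

text \<open>With \<open>g\<close> the gcd of \<open>d\<close> and \<open>m\<close>, the cofactor
  \<open>d'\<close> of \<open>d\<close> is coprime to that of \<open>m\<close> and so divides
  \<open>g\<close>. Hence its square divides \<open>d\<close>, and it is a unit.\<close>

lemma squarefree_dvd_square_imp_dvd:
  fixes d m :: int
  assumes "squarefree d" "d dvd m ^ 2"
  shows "d dvd m"
proof (cases "d = 0")
  case False
  define g where "g = gcd d m"
  have g: "g \<noteq> 0" using False by (simp add: g_def)
  obtain d' m' where d': "d = d' * g" and m': "m = m' * g" and cop: "coprime d' m'"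
    using gcd_coprime_exists[of d m] g unfolding g_def by blast
  have "d' * g dvd (m' ^ 2 * g) * g" using assms(2) by (simp add: d' m' power2_eq_square mult_ac)
  hence "d' dvd m' ^ 2 * g" using g by simp
  hence "d' dvd g" using cop by (simp add: coprime_dvd_mult_right_iff)
  hence "d' ^ 2 dvd d" by (simp add: d' power2_eq_square)
  hence "d' dvd 1" using assms(1) by (simp add: squarefree_def)
  hence "d dvd g" by (auto simp: d')
  thus ?thesis by (metis g_def gcd_dvd2 dvd_trans)
qed (use assms in auto)

text \<open>Squarefreeness turns the square into \<open>b^2 - 4 d = d k^2\<close> and makes
  \<open>d\<close> divide \<open>b\<close>. With \<open>b = d * c\<close> this becomes
  \<open>d c^2 = 4 + k^2\<close>, which is 5 or 8 since \<open>k\<close> divides 2. The pair (5, 5)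
  survives here and is excluded by \<open>not_5_5\<close>.\<close>

lemma cyclic_integral_parameters:
  fixes b d :: int and r :: rat
  assumes sqf: "squarefree d" and r: "r ^ 2 = of_int (d * (b\<^sup>2 - 4 * d))"
    and k2: "\<And>k. b\<^sup>2 - 4 * d = d * k\<^sup>2 \<Longrightarrow> k \<noteq> 0 \<Longrightarrow> k dvd 2"
    and nz: "b\<^sup>2 - 4 * d \<noteq> 0"
  shows "(b, d) \<in> {(-4, 2), (4, 2), (-5, 5), (5, 5)}"
proof -
  have d: "d \<noteq> 0" using sqf by auto
  obtain m where m: "d * (b\<^sup>2 - 4 * d) = m ^ 2"
    using rational_square_imp_square[OF r] by blast
  hence "d dvd m ^ 2" by (metis dvd_triv_left)
  hence "d dvd m" by (rule squarefree_dvd_square_imp_dvd[OF sqf])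
  then obtain k where "m = d * k" by auto
  with m d have k: "b\<^sup>2 - 4 * d = d * k\<^sup>2"
    by (simp add: power2_eq_square mult_ac)
  have "d dvd b ^ 2" using k by (metis add.commute diff_add_cancel dvd_add dvd_triv_left dvd_triv_right)
  hence "d dvd b" by (rule squarefree_dvd_square_imp_dvd[OF sqf])
  then obtain c where c: "b = d * c" by auto
  have "d * (d * c\<^sup>2) = d * (4 + k\<^sup>2)" using k by (simp add: c algebra_simps power2_eq_square)
  hence dc: "d * c\<^sup>2 = 4 + k\<^sup>2" using d by simp
  have "k \<noteq> 0" using k nz by auto
  with k2[OF k] have "k dvd 2" by blast
  hence "\<bar>k\<bar> \<le> 2" using zdvd_imp_le[of "\<bar>k\<bar>" 2] by simp
  with \<open>k \<noteq> 0\<close> have "k \<in> {-2, -1, 1, 2}" by auto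
  hence "k\<^sup>2 = 1 \<or> k\<^sup>2 = 4" by auto
  hence dc': "d * c\<^sup>2 = 5 \<or> d * c\<^sup>2 = 8" using dc by auto
  hence "c \<noteq> 0" by auto
  hence cpos: "c\<^sup>2 > 0" by simp
  have "d * c\<^sup>2 > 0" using dc' by linarith
  hence dpos: "d > 0" using cpos by (simp add: zero_less_mult_iff)
  hence "1 * c\<^sup>2 \<le> d * c\<^sup>2" by (intro mult_right_mono) auto
  hence "c\<^sup>2 < 3\<^sup>2" using dc' by auto
  hence "\<bar>c\<bar> < 3" using abs_le_square_iff[of 3 c] by auto
  with \<open>c \<noteq> 0\<close> have c4: "c \<in> {-2, -1, 1, 2}" by auto
  have d8: "d \<noteq> 8"
  proof
    assume "d = 8"
    hence "(2 :: int) ^ 2 dvd d" by simp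
    with sqf have "(2 :: int) dvd 1" unfolding squarefree_def by blast
    thus False by simp
  qed
  from c4 have "c\<^sup>2 = 1 \<or> c\<^sup>2 = 4" by auto
  thus ?thesis
  proof
    assume "c\<^sup>2 = 1"
    with dc' d8 have "d = 5" by simp
    moreover have "c = 1 \<or> c = -1" using \<open>c\<^sup>2 = 1\<close> by (simp add: power2_eq_1_iff)
    ultimately show ?thesis by (auto simp: c)
  next
    assume c2: "c\<^sup>2 = 4"
    with dc' have "d * 4 = 5 \<or> d * 4 = 8" by simp
    hence "d = 2" by presburger
    moreover have "c = 2 \<or> c = -2" using c4 c2 by auto
    ultimately show ?thesis by (auto simp: c)
  qed
qed

lemma monogenic_cyclic_imp:
  assumes "monogenic [:d, 0, b, 0, 1:]" "galois_group [:d, 0, b, 0, 1:] \<cong> integer_mod_group 4"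
  shows "(b, d) \<in> {(-4, 2), (4, 2), (-5, 5)}"
proof -
  define f where "f = [:of_int d, 0, of_int b, 0, 1 :: complex:]"
  have "\<not> constant (poly f)" by (simp add: f_def constant_degree)
  then obtain \<theta> where "poly f \<theta> = 0" using fundamental_theorem_of_algebra by blast
  hence root: "\<theta> ^ 4 + of_int b * \<theta> ^ 2 + of_int d = 0"
    by (simp add: f_def algebra_simps power2_eq_square power4_eq_xxxx)
  interpret biquadratic b d \<theta>
    using assms(1) root by unfold_locales (auto simp: monogenic_biquadratic_iff)
  have integral: "ring_of_integers (adjoin_Rats {\<theta>}) = integral_cubics"
    using assms(1) root by (simp add: monogenic_biquadratic_iff)
  obtain r :: rat where r: "r ^ 2 = of_int (d * (b\<^sup>2 - 4 * d))"
    using cyclic_imp_square[OF assms(2)] by blast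
  \<comment> \<open>With discriminant zero, \<open>b / 2\<close> would be a zero forbidden by
    \<open>no_rational_root\<close>.\<close>
  have "b\<^sup>2 - 4 * d \<noteq> 0"
  proof
    assume "b\<^sup>2 - 4 * d = 0"
    hence "of_int (b\<^sup>2 - 4 * d) = (0 :: rat)" by simp
    hence "(of_int b / 2) ^ 2 - of_int b * (of_int b / 2) + of_int d = (0 :: rat)"
      by (simp add: field_simps power2_eq_square)
    thus False using no_rational_root by blast
  qed
  with cyclic_integral_parameters[OF squarefree_d[OF integral] r conductor_dvd_2[OF integral]]
  show ?thesis using not_5_5[OF integral] by auto
qed

section \<open>Nonsquares and irreducibility\<close>

lemma not_int_square:
  fixes k n :: int
  assumes "k\<^sup>2 < n" "n < (k + 1)\<^sup>2" "k \<ge> 0"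
  shows "m\<^sup>2 \<noteq> n"
proof
  assume "m\<^sup>2 = n"
  hence "k < \<bar>m\<bar>" "\<bar>m\<bar> < k + 1"
    using assms power2_less_imp_less[of k "\<bar>m\<bar>"] power2_less_imp_less[of "\<bar>m\<bar>" "k + 1"] by auto
  thus False by simp
qed

lemma not_rational_square:
  fixes k n :: int and r :: rat
  assumes "k\<^sup>2 < n" "n < (k + 1)\<^sup>2" "k \<ge> 0"
  shows "r\<^sup>2 \<noteq> of_int n"
  using rational_square_imp_square[of r n] not_int_square[OF assms] by metis

text \<open>
  Over \<open>\<rat>(\<theta>\<^sup>2)\<close>, a relation \<open>A + B \<theta> = 0\<close> with \<open>B \<noteq> 0\<close> gives \<open>A\<^sup>2 = B\<^sup>2 \<theta>\<^sup>2\<close>, whose norm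
  exhibits \<open>d\<close> as a square.
\<close>

lemma irreducible_biquadratic:
  fixes b d :: int
  assumes d: "\<And>r :: rat. r\<^sup>2 \<noteq> of_int d" and D: "\<And>r :: rat. r\<^sup>2 \<noteq> of_int (b\<^sup>2 - 4 * d)"
  shows "irreducible [:of_int d, 0, of_int b, 0, 1 :: rat:]" (is "irreducible ?f")
proof -
  have "\<not> constant (poly (map_poly of_rat ?f :: complex poly))"
    by (simp add: constant_degree)
  then obtain z :: complex where z: "rpoly ?f z = 0"
    using fundamental_theorem_of_algebra by blast
  hence root: "z ^ 4 + of_int b * z ^ 2 + of_int d = 0" by (simp only: rpoly_biquadratic)
  \<comment> \<open>The norm form has discriminant \<open>b^2 - 4 d\<close>, which a nontrivial
    rational zero would exhibit as a square.\<close>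
  have norm: "u = 0 \<and> v = 0" if "u\<^sup>2 - of_int b * u * v + of_int d * v\<^sup>2 = 0" for u v :: rat
  proof (cases "v = 0")
    case False
    have "(2 * u - of_int b * v)\<^sup>2 = of_int (b\<^sup>2 - 4 * d) * v\<^sup>2
        + 4 * (u\<^sup>2 - of_int b * u * v + of_int d * v\<^sup>2)"
      by (simp add: algebra_simps power2_eq_square)
    hence "((2 * u - of_int b * v) / v)\<^sup>2 = of_int (b\<^sup>2 - 4 * d)"
      using False that by (simp add: power_divide)
    thus ?thesis using D by blast
  qed (use that in simp)
  \<comment> \<open>Multiplying by the conjugate, in which \<open>z^2\<close> becomes
    \<open>- b - z^2\<close>, yields the norm form.\<close>
  have lin: "u = 0 \<and> v = 0" if uv: "of_rat u + of_rat v * z ^ 2 = 0" for u v :: rat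
  proof -
    have "(of_rat u + of_rat v * z ^ 2) * (of_rat u - of_rat v * (z ^ 2 + of_int b))
        + of_rat v ^ 2 * (z ^ 4 + of_int b * z ^ 2 + of_int d) =
        of_rat (u\<^sup>2 - of_int b * u * v + of_int d * v\<^sup>2)"
      by (simp add: of_rat_add of_rat_diff of_rat_mult of_rat_power algebra_simps
          power2_eq_square power4_eq_xxxx)
    hence "of_rat (u\<^sup>2 - of_int b * u * v + of_int d * v\<^sup>2) = (0 :: complex)"
      unfolding uv root by simp
    hence "u\<^sup>2 - of_int b * u * v + of_int d * v\<^sup>2 = 0" by (simp only: of_rat_eq_0_iff)
    thus ?thesis by (rule norm)
  qed
  have cubic: "p0 = 0 \<and> p1 = 0 \<and> p2 = 0 \<and> p3 = 0" if p: "rpoly [:p0, p1, p2, p3:] z = 0"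
    for p0 p1 p2 p3
  proof -
    \<comment> \<open>Let \<open>A = p0 + p2 z^2\<close> and \<open>B = p1 + p3 z^2\<close>, this
      \<open>B\<close> being unrelated to the constant fixed below. Then
      \<open>B^2 = S + T z^2\<close> and \<open>A^2 - z^2 B^2 = U + V z^2\<close>, while
      \<open>NA\<close> and \<open>NB\<close> are the norms of \<open>A\<close> and
      \<open>B\<close>.\<close>
    define S T where "S = p1\<^sup>2 - of_int d * p3\<^sup>2" and "T = 2 * p1 * p3 - of_int b * p3\<^sup>2"
    define U V where "U = p0\<^sup>2 - of_int d * p2\<^sup>2 + of_int d * T"
      and "V = 2 * p0 * p2 - of_int b * p2\<^sup>2 - (S - of_int b * T)"
    define NA NB where "NA = p0\<^sup>2 - of_int b * p0 * p2 + of_int d * p2\<^sup>2"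
      and "NB = p1\<^sup>2 - of_int b * p1 * p3 + of_int d * p3\<^sup>2"
    define q0 q1 q2 q3 B D :: complex where q: "q0 = of_rat p0" "q1 = of_rat p1" "q2 = of_rat p2"
      "q3 = of_rat p3" "B = of_int b" "D = of_int d"
    have "of_rat U + of_rat V * z ^ 2 =
        (q0\<^sup>2 - D * q2\<^sup>2 + D * (2 * q1 * q3 - B * q3\<^sup>2)) +
        (2 * q0 * q2 - B * q2\<^sup>2 - (q1\<^sup>2 - D * q3\<^sup>2 - B * (2 * q1 * q3 - B * q3\<^sup>2))) * z\<^sup>2"
      by (simp add: U_def V_def S_def T_def q of_rat_add of_rat_diff of_rat_mult of_rat_power)
    also have "\<dots> = (q0 + q1 * z + q2 * z ^ 2 + q3 * z ^ 3) * ((q0 + q2 * z ^ 2) - (q1 * z + q3 * z ^ 3))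
        - (q2\<^sup>2 - q3\<^sup>2 * (z\<^sup>2 - B) - 2 * q1 * q3) * (z ^ 4 + B * z ^ 2 + D)"
      by (simp add: algebra_simps power2_eq_square power3_eq_cube power4_eq_xxxx)
    also have "\<dots> = 0"
      using p root unfolding rpoly_cubic q by simp
    finally have UV: "U = 0" "V = 0" using lin by blast+
    \<comment> \<open>Multiplicativity of the norm, applied to \<open>A^2 = z^2 B^2\<close>, as an
      explicit identity modulo \<open>U\<close> and \<open>V\<close>; the norm of \<open>z^2\<close>
      is \<open>d\<close>.\<close>
    have "NA\<^sup>2 - of_int d * NB\<^sup>2 = U * (U - 2 * of_int d * T) 
       - of_int b * (U * V + U * (S - of_int b * T) - of_int d * T * V)
       + of_int d * (V * (V + 2 * (S - of_int b * T)))"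
      by (simp add: NA_def NB_def U_def V_def S_def T_def algebra_simps power2_eq_square)
    hence eq: "NA\<^sup>2 = of_int d * NB\<^sup>2" by (simp add: UV)
    have "NB = 0"
    proof (rule ccontr)
      assume "NB \<noteq> 0"
      hence "(NA / NB)\<^sup>2 = of_int d" using eq by (simp add: power_divide)
      thus False using d by blast
    qed
    moreover from this have "NA = 0" using eq by simp
    ultimately show ?thesis using norm[of p0 p2] norm[of p1 p3] by (simp add: NA_def NB_def)
  qed
  \<comment> \<open>No nonzero rational polynomial of degree below 4 vanishes at \<open>z\<close>,
    which leaves no room for a proper factor.\<close>
  have small: "q = 0" if "degree q < 4" "rpoly q z = 0" for q
  proof -
    have q: "q = [:coeff q 0, coeff q 1, coeff q 2, coeff q 3:]"
      using poly_le_cubic_eq[OF that(1)] .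
    have "rpoly [:coeff q 0, coeff q 1, coeff q 2, coeff q 3:] z = 0"
      using that(2) by (subst (asm) q)
    from cubic[OF this] q show ?thesis by simp
  qed
  show ?thesis
  proof (rule irreducibleI)
    show "?f \<noteq> 0" by simp
    show "\<not> ?f dvd 1" by (simp add: is_unit_iff_degree)
    fix g h assume gh: "?f = g * h"
    hence nz: "g \<noteq> 0" "h \<noteq> 0" by (metis mult_zero_left mult_zero_right pCons_eq_0_iff zero_neq_one)+
    have "degree ?f = 4" by simp
    hence deg: "degree g + degree h = 4" using degree_mult_eq[OF nz] by (simp only: gh)
    have "rpoly g z * rpoly h z = 0" using z unfolding gh rpoly_mult .
    hence "degree g \<ge> 4 \<or> degree h \<ge> 4" using small nz by (meson mult_eq_0_iff not_le)
    thus "g dvd 1 \<or> h dvd 1" using deg nz by (auto simp: is_unit_iff_degree)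
  qed
qed

section \<open>Construction of a cyclic Galois group\<close>

context biquadratic
begin

text \<open>Substituting \<open>\<phi>\<close> for \<open>\<theta>\<close> gives an automorphism
  whose powers send \<open>\<theta>\<close> to the four roots in turn. An automorphism is determined
  by the image of \<open>\<theta>\<close>, which is one of these roots, so the powers exhaust the
  group.\<close>

lemma cyclic_if_gen_quartic_automorphism:
  assumes \<phi>2: "\<phi>\<^sup>2 = - of_int b - \<theta>\<^sup>2" and q: "\<phi> = rpoly q \<theta>" "rpoly q \<phi> = - \<theta>"
  shows "galois_group [:d, 0, b, 0, 1:] \<cong> integer_mod_group 4"
proof -
  define f where "f = [:d, 0, b, 0, 1:]"
  define L where "L = adjoin_Rats (int_poly_roots f)"
  note C = carrier_galois_group[OF L_def]
  have roots: "int_poly_roots f = {\<theta>, - \<theta>, \<phi>, - \<phi>}"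
    unfolding f_def by (rule int_poly_roots_eq[OF \<phi>2])
  have \<phi>root: "rpoly minpoly \<phi> = 0"
    using roots unfolding f_def set_eq_iff int_poly_roots_biquadratic rpoly_biquadratic by blast
  have L: "complex_subfield L" by (simp add: L_def complex_subfield_adjoin_Rats)
  have L_eq: "L = range (\<lambda>p. rpoly p \<theta>)"
  proof -
    have K: "complex_subfield (adjoin_Rats {\<theta>})" by (rule complex_subfield_adjoin_Rats)
    have "\<theta> \<in> adjoin_Rats {\<theta>}" using adjoin_Rats_incl by blast
    moreover from rpoly_in_complex_subfield[OF K this] have "\<phi> \<in> adjoin_Rats {\<theta>}"
      by (simp add: q(1))
    ultimately have "L \<subseteq> adjoin_Rats {\<theta>}"
      unfolding L_def roots using complex_subfieldD(4)[OF K] by (intro adjoin_Rats_least K) auto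
    moreover have "\<theta> \<in> L" using adjoin_Rats_incl[of "int_poly_roots f"] by (auto simp: L_def roots)
    hence "adjoin_Rats {\<theta>} \<subseteq> L" by (intro adjoin_Rats_least L) simp
    ultimately show ?thesis
      unfolding adjoin_Rats_singleton[OF irred rpoly_minpoly, symmetric] by blast
  qed
  have inL: "rpoly p \<theta> \<in> L" for p by (simp add: L_eq)
  have \<theta>L: "\<theta> \<in> L" and \<phi>L: "\<phi> \<in> L" and mL: "- \<theta> \<in> L" "- \<phi> \<in> L"
    using adjoin_Rats_incl[of "int_poly_roots f"] by (auto simp: L_def roots)
  \<comment> \<open>The choice of the representing polynomial does not affect the value, by
    \<open>rpoly_eq_conjugate\<close>.\<close>
  define \<sigma> where "\<sigma> x = rpoly (SOME p. rpoly p \<theta> = x) \<phi>" for x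
  have \<sigma>: "\<sigma> (rpoly p \<theta>) = rpoly p \<phi>" for p
  proof -
    have "rpoly (SOME p'. rpoly p' \<theta> = rpoly p \<theta>) \<theta> = rpoly p \<theta>"
      by (rule someI[where P = "\<lambda>p'. rpoly p' \<theta> = rpoly p \<theta>"]) (rule refl)
    thus ?thesis
      unfolding \<sigma>_def using rpoly_eq_conjugate[OF irred rpoly_minpoly \<phi>root] by blast
  qed
  have \<sigma>L: "\<sigma> x \<in> L" if xL: "x \<in> L" for x
  proof -
    obtain p where "x = rpoly p \<theta>" using xL unfolding L_eq by blast
    thus ?thesis using rpoly_in_complex_subfield[OF L \<phi>L] by (simp add: \<sigma>)
  qed
  have \<sigma>add: "\<sigma> (x + y) = \<sigma> x + \<sigma> y" and \<sigma>mult: "\<sigma> (x * y) = \<sigma> x * \<sigma> y"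
    if xy: "x \<in> L" "y \<in> L" for x y
  proof -
    obtain p r where "x = rpoly p \<theta>" "y = rpoly r \<theta>" using xy unfolding L_eq by blast
    thus "\<sigma> (x + y) = \<sigma> x + \<sigma> y" "\<sigma> (x * y) = \<sigma> x * \<sigma> y"
      by (simp_all only: rpoly_add[symmetric] rpoly_mult[symmetric] \<sigma>)
  qed
  have \<sigma>rat: "\<sigma> r = r" if rQ: "r \<in> \<rat>" for r
  proof -
    obtain s where s: "r = of_rat s" using rQ by (auto elim: Rats_cases)
    show ?thesis using \<sigma>[of "[:s:]"] by (simp add: s hom_distribs)
  qed
  have \<sigma>poly: "\<sigma> (rpoly p x) = rpoly p (\<sigma> x)" if "x \<in> L" for p x
    using that by (intro hom_rpoly[OF L]) (auto simp: \<sigma>add \<sigma>mult \<sigma>rat)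
  have \<sigma>minus: "\<sigma> (- x) = - \<sigma> x" if "x \<in> L" for x
    using \<sigma>mult[of "-1" x] \<sigma>rat[of "-1"] complex_subfieldD(1)[OF L, of "-1"] that by simp
  have \<sigma>\<theta>: "\<sigma> \<theta> = \<phi>" using \<sigma>[of "[:0, 1:]"] by (simp add: hom_distribs)
  have \<sigma>\<phi>: "\<sigma> \<phi> = - \<theta>" using \<sigma>poly[OF \<theta>L, of q] q \<sigma>\<theta> by simp
  have powL: "(\<sigma> ^^ n) x \<in> L" if "x \<in> L" for x n
    using that by (induction n) (auto simp: \<sigma>L)
  have pow: "(\<sigma> ^^ n) (x + y) = (\<sigma> ^^ n) x + (\<sigma> ^^ n) y"
    "(\<sigma> ^^ n) (x * y) = (\<sigma> ^^ n) x * (\<sigma> ^^ n) y"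
    if "x \<in> L" "y \<in> L" for x y n
    using that by (induction n) (auto simp: powL \<sigma>add \<sigma>mult)
  have powrat: "(\<sigma> ^^ n) r = r" if "r \<in> \<rat>" for r n
    using that by (induction n) (auto simp: \<sigma>rat)
  have powpoly: "(\<sigma> ^^ n) (rpoly p x) = rpoly p ((\<sigma> ^^ n) x)" if "x \<in> L" for p x n
    using that by (intro hom_rpoly[OF L]) (auto simp: pow powrat)
  have \<sigma>1: "(\<sigma> ^^ 1) \<theta> = \<phi>" and \<sigma>2: "(\<sigma> ^^ 2) \<theta> = - \<theta>" and \<sigma>3: "(\<sigma> ^^ 3) \<theta> = - \<phi>"
    and \<sigma>4: "(\<sigma> ^^ 4) \<theta> = \<theta>"
    by (simp_all add: numeral_eq_Suc \<sigma>\<theta> \<sigma>\<phi> \<sigma>minus \<theta>L \<phi>L)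
  have order4: "(\<sigma> ^^ 4) x = x" if "x \<in> L" for x
    using that powpoly[OF \<theta>L, of 4] \<sigma>4 unfolding L_eq by auto
  have "bij_betw \<sigma> L L"
  proof (rule bij_betw_byWitness[where f' = "\<sigma> ^^ 3"])
    show "\<forall>x\<in>L. (\<sigma> ^^ 3) (\<sigma> x) = x" "\<forall>x\<in>L. \<sigma> ((\<sigma> ^^ 3) x) = x"
      using order4 by (simp_all add: numeral_eq_Suc)
    show "\<sigma> ` L \<subseteq> L" "(\<sigma> ^^ 3) ` L \<subseteq> L" using \<sigma>L powL[of _ 3] by blast+
  qed
  hence bij: "bij_betw (\<sigma> ^^ n) L L" for n by (rule bij_betw_funpow)
  \<comment> \<open>Residues modulo 4 are integers here, hence \<open>nat i\<close>; restriction to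
    \<open>L\<close> supplies extensionality.\<close>
  define H where "H i = restrict (\<sigma> ^^ nat i) L" for i :: int
  have H: "H i x = (\<sigma> ^^ nat i) x" if "x \<in> L" for i x using that by (simp add: H_def)
  have HG: "H i \<in> carrier (galois_group f)" for i
    unfolding C using complex_subfieldD(1-3)[OF L]
    by (auto simp: H pow powrat H_def bij cong: bij_betw_cong)
  have Z4: "carrier (integer_mod_group 4) = {0, 1, 2, 3}"
    by (auto simp: carrier_integer_mod_group)
  have ne: "\<theta> \<noteq> \<phi>" "\<theta> \<noteq> - \<phi>" "\<theta> \<noteq> - \<theta>" "\<phi> \<noteq> - \<phi>"
  proof -
    show 1: "\<theta> \<noteq> \<phi>"
    proof
      assume "\<theta> = \<phi>"
      hence "\<theta> = - \<theta>" using \<sigma>\<theta> \<sigma>\<phi> by metis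
      thus False using complex_eq_minus_self_imp_0 gen_nonzero by blast
    qed
    show "\<theta> \<noteq> - \<phi>"
    proof
      assume *: "\<theta> = - \<phi>"
      hence "\<sigma> \<theta> = - \<sigma> \<phi>" using \<sigma>minus[OF \<phi>L] by simp
      thus False using 1 \<sigma>\<theta> \<sigma>\<phi> by simp
    qed
    show "\<theta> \<noteq> - \<theta>" using complex_eq_minus_self_imp_0 gen_nonzero by blast
    show "\<phi> \<noteq> - \<phi>"
    proof
      assume "\<phi> = - \<phi>"
      hence "\<phi> = 0" by (rule complex_eq_minus_self_imp_0)
      thus False using \<sigma>\<phi> \<sigma>rat[of 0] gen_nonzero by simp
    qed
  qed
  have ne': "- \<theta> \<noteq> \<phi>" "- \<phi> \<noteq> \<theta>" using ne(2) by (metis minus_minus)+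
  have "H \<in> iso (integer_mod_group 4) (galois_group f)"
    unfolding iso_def mem_Collect_eq
  proof (rule conjI)
    show "H \<in> hom (integer_mod_group 4) (galois_group f)"
    proof (rule homI)
      fix i j assume "i \<in> carrier (integer_mod_group 4)" "j \<in> carrier (integer_mod_group 4)"
      hence ij: "i \<ge> 0" "j \<ge> 0" by (auto simp: Z4)
      have "H ((i + j) mod 4) x = compose L (H i) (H j) x" for x
      proof (cases "x \<in> L")
        case True
        have "nat ((i + j) mod 4) = (nat i + nat j) mod 4"
          using ij by (simp add: nat_mod_distrib nat_add_distrib)
        hence "H ((i + j) mod 4) x = (\<sigma> ^^ (nat i + nat j)) x"
          using True by (simp add: H funpow_mod_eq order4)
        also have "\<dots> = H i (H j x)"
          using True powL by (simp add: H funpow_add)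
        finally show ?thesis using True by (simp add: compose_eq)
      qed (simp add: H_def compose_def)
      thus "H (i \<otimes>\<^bsub>integer_mod_group 4\<^esub> j) = H i \<otimes>\<^bsub>galois_group f\<^esub> H j"
        using mult_galois_group[OF L_def HG HG] by (simp add: fun_eq_iff)
    qed (rule HG)
    have inj: "inj_on H {0, 1, 2, 3}"
    proof (rule inj_onI)
      fix i j :: int assume "i \<in> {0, 1, 2, 3}" "j \<in> {0, 1, 2, 3}" "H i = H j"
      moreover from this have "(\<sigma> ^^ nat i) \<theta> = (\<sigma> ^^ nat j) \<theta>" using H[OF \<theta>L] by metis
      ultimately show "i = j"
        using ne ne[symmetric] ne' \<sigma>1 \<sigma>2 \<sigma>3 by auto
    qed
    have "\<tau> \<in> H ` {0, 1, 2, 3}" if \<tau>: "\<tau> \<in> carrier (galois_group f)" for \<tau>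
    proof -
      have \<tau>poly: "\<tau> (rpoly p x) = rpoly p (\<tau> x)" if "x \<in> L" for p x
        using that \<tau> by (intro hom_rpoly[OF L]) (auto simp: C)
      have "rpoly minpoly (\<tau> \<theta>) = 0"
        using \<tau>poly[OF \<theta>L, of minpoly] \<tau> unfolding rpoly_minpoly by (simp add: C)
      hence "\<tau> \<theta> \<in> int_poly_roots f"
        unfolding f_def int_poly_roots_biquadratic rpoly_biquadratic .
      hence "\<exists>i\<in>{0, 1, 2, 3}. \<tau> \<theta> = H i \<theta>"
        unfolding roots H[OF \<theta>L] using \<sigma>1 \<sigma>2 \<sigma>3 by auto
      then obtain i where i: "i \<in> {0, 1, 2, 3}" "\<tau> \<theta> = H i \<theta>" by blast
      have "\<tau> x = H i x" if xL: "x \<in> L" for x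
      proof -
        obtain p where x: "x = rpoly p \<theta>" using xL unfolding L_eq by blast
        have "\<tau> x = rpoly p (H i \<theta>)" unfolding x \<tau>poly[OF \<theta>L] i(2) ..
        also have "\<dots> = (\<sigma> ^^ nat i) x" unfolding H[OF \<theta>L] x powpoly[OF \<theta>L] ..
        also have "\<dots> = H i x" using H[OF xL] by simp
        finally show ?thesis .
      qed
      hence "\<tau> = H i"
        using \<tau> HG[of i] by (intro extensionalityI[of _ L]) (auto simp: C)
      with i(1) show ?thesis by blast
    qed
    thus "bij_betw H (carrier (integer_mod_group 4)) (carrier (galois_group f))"
      unfolding Z4 bij_betw_def using inj HG by blast
  qed
  hence "integer_mod_group 4 \<cong> galois_group f" unfolding is_iso_def by blast
  thus ?thesis unfolding f_def by (rule group.iso_sym[OF group_integer_mod_group])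
qed

end

section \<open>Non-isomorphic fields\<close>

text \<open>A ring isomorphism fixes the rationals and so carries roots to roots. Solvability of a
  rational equation is the invariant that tells the quartic fields apart.\<close>

lemma ring_iso_root_iff:
  assumes K: "complex_subfield K" "complex_subfield K'"
    and iso: "complex_subring K \<simeq> complex_subring K'"
  shows "(\<exists>x\<in>K. rpoly p x = 0) \<longleftrightarrow> (\<exists>x\<in>K'. rpoly p x = 0)"
proof -
  obtain h where h: "h \<in> ring_iso (complex_subring K) (complex_subring K')"
    using iso by (auto simp: is_ring_iso_def)
  have hadd: "h (x + y) = h x + h y" and hmult: "h (x * y) = h x * h y"
    if "x \<in> K" "y \<in> K" for x y
    using ring_iso_memE(2,3)[OF h, of x y] that by (simp_all add: complex_subring_def)
  have hone: "h 1 = 1"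
    using ring_iso_memE(4)[OF h] by (simp add: complex_subring_def)
  have hbij: "bij_betw h K K'"
    using ring_iso_memE(5)[OF h] by (simp add: complex_subring_def)
  have rat: "h q = q" if "q \<in> \<rat>" for q
    using hadd hmult hone that by (rule additive_unit_hom_fixes_Rats[OF K(1)])
  have poly: "h (rpoly p x) = rpoly p (h x)" if "x \<in> K" for x
    using hadd hmult rat by (rule hom_rpoly[OF K(1) that])
  have "rpoly p x = 0 \<longleftrightarrow> rpoly p (h x) = 0" if "x \<in> K" for x
  proof -
    have "rpoly p x = 0 \<longleftrightarrow> h (rpoly p x) = h 0"
      using hbij rpoly_in_complex_subfield[OF K(1) that] complex_subfieldD(1)[OF K(1), of 0]
      by (auto simp: bij_betw_def inj_on_def)
    thus ?thesis using poly[OF that] rat[of 0] by simp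
  qed
  moreover have "K' = h ` K" using hbij by (simp add: bij_betw_def)
  ultimately show ?thesis by auto
qed

lemma real_if_square_real:
  fixes z :: complex
  assumes "z\<^sup>2 = of_real t" "t \<ge> 0"
  shows "z \<in> \<real>"
proof -
  have "z\<^sup>2 = (of_real (sqrt t))\<^sup>2" using assms by (simp flip: of_real_power)
  hence "z = of_real (sqrt t) \<or> z = - of_real (sqrt t)" by (simp add: power2_eq_iff)
  thus ?thesis by auto
qed

text \<open>Since \<open>d \<ge> 0\<close>, the square root of \<open>b^2 - 4 d\<close> is at most
  \<open>- b\<close>, so both possible values of \<open>z^2\<close> are nonnegative reals.\<close>

lemma real_root_if_totally_real:
  fixes b d :: int and z :: complex
  assumes root: "z ^ 4 + of_int b * z ^ 2 + of_int d = 0"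
    and "b \<le> 0" "d \<ge> 0" "b\<^sup>2 - 4 * d \<ge> 0"
  shows "z \<in> \<real>"
proof -
  define D where "D = (of_int (b\<^sup>2 - 4 * d) :: real)"
  have D: "0 \<le> D" unfolding D_def using assms(4) by (simp only: of_int_0_le_iff)
  have "of_int (b\<^sup>2 - 4 * d) \<le> (of_int (b\<^sup>2) :: real)" using assms(3) by (intro of_int_le_iff[THEN iffD2]) simp
  hence "D \<le> (of_int b)\<^sup>2" by (simp add: D_def)
  hence "sqrt D \<le> \<bar>of_int b\<bar>" by (metis real_sqrt_abs real_sqrt_le_mono)
  hence sb: "sqrt D \<le> - of_int b" using assms(2) by simp
  have "(2 * z\<^sup>2 + of_int b)\<^sup>2 = 4 * (z ^ 4 + of_int b * z ^ 2 + of_int d) + of_int (b\<^sup>2 - 4 * d)"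
    by (simp add: algebra_simps power2_eq_square power4_eq_xxxx)
  also have "\<dots> = of_real D" using root by (simp add: D_def)
  also have "\<dots> = (of_real (sqrt D))\<^sup>2" using D by (simp flip: of_real_power)
  finally have sq: "2 * z\<^sup>2 + of_int b = of_real (sqrt D) \<or> 2 * z\<^sup>2 + of_int b = - of_real (sqrt D)"
    by (simp only: power2_eq_iff)
  have z2: "z\<^sup>2 = (2 * z\<^sup>2 + of_int b - of_int b) / 2" by simp
  from sq show ?thesis
  proof
    assume eq: "2 * z\<^sup>2 + of_int b = of_real (sqrt D)"
    have "z\<^sup>2 = of_real ((sqrt D - of_int b) / 2)" by (subst z2, subst eq) simp
    moreover have "(sqrt D - of_int b) / 2 \<ge> 0" 
      using sb real_sqrt_ge_zero[OF D] by (intro divide_nonneg_pos) linarith+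
    ultimately show ?thesis by (rule real_if_square_real)
  next
    assume eq: "2 * z\<^sup>2 + of_int b = - of_real (sqrt D)"
    have "z\<^sup>2 = of_real ((- sqrt D - of_int b) / 2)" by (subst z2, subst eq) simp
    moreover have "(- sqrt D - of_int b) / 2 \<ge> 0" using sb by simp
    ultimately show ?thesis by (rule real_if_square_real)
  qed
qed

lemma of_rat_in_Reals: "(of_rat r :: complex) \<in> \<real>"
proof -
  obtain a c where "quotient_of r = (a, c)" by fastforce
  from quotient_of_div[OF this] show ?thesis by (simp add: of_rat_divide)
qed

lemma adjoin_real_subset_Reals:
  assumes "z \<in> \<real>"
  shows "adjoin_Rats {z} \<subseteq> \<real>"
proof (rule adjoin_Rats_least)
  show "complex_subfield \<real>"
    unfolding complex_subfield_def by (auto elim!: Rats_cases simp: of_rat_in_Reals)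
qed (use assms in simp)

lemma no_real_root_x4_4x2_2:
  assumes "z \<in> \<real>"
  shows "rpoly [:of_int 2, 0, of_int 4, 0, 1:] z \<noteq> 0"
proof -
  obtain x where x: "z = of_real x" using assms by (auto elim: Reals_cases)
  have "x ^ 4 + 4 * x ^ 2 + 2 > 0"
    by (intro add_nonneg_pos add_nonneg_nonneg) auto
  hence "of_real (x ^ 4 + 4 * x ^ 2 + 2) \<noteq> (0 :: complex)" by (simp only: of_real_eq_0_iff)
  thus ?thesis unfolding rpoly_biquadratic by (simp add: x)
qed

text \<open>The polynomial \<open>x^4 + 4 x^2 + 2\<close> has a root in the field it generates but
  no real root, while the other field lies in \<open>\<real>\<close>. Both orders occur among the
  pairs to be compared.\<close>

lemma generate_nonisomorphic_fields_real_imaginary: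
  fixes b d :: int
  assumes "b \<le> 0" "d \<ge> 0" "b\<^sup>2 - 4 * d \<ge> 0"
  shows "generate_nonisomorphic_fields [:d, 0, b, 0, 1:] [:2, 0, 4, 0, 1:]"
    and "generate_nonisomorphic_fields [:2, 0, 4, 0, 1:] [:d, 0, b, 0, 1:]"
proof -
  let ?p = "[:of_int 2, 0, of_int 4, 0, 1 :: rat:]"
  have no: "\<not> (\<exists>x\<in>adjoin_Rats {\<alpha>}. rpoly ?p x = 0)" if "\<alpha> \<in> int_poly_roots [:d, 0, b, 0, 1:]" for \<alpha>
    using no_real_root_x4_4x2_2 real_root_if_totally_real[OF _ assms] adjoin_real_subset_Reals that
    unfolding int_poly_roots_biquadratic by blast
  have yes: "\<exists>x\<in>adjoin_Rats {\<alpha>}. rpoly ?p x = 0" if "\<alpha> \<in> int_poly_roots [:2, 0, 4, 0, 1:]" for \<alpha>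
    using that adjoin_Rats_incl[of "{\<alpha>}"]
    unfolding int_poly_roots_biquadratic rpoly_biquadratic by blast
  show "generate_nonisomorphic_fields [:d, 0, b, 0, 1:] [:2, 0, 4, 0, 1:]"
    and "generate_nonisomorphic_fields [:2, 0, 4, 0, 1:] [:d, 0, b, 0, 1:]"
    using no yes ring_iso_root_iff[OF complex_subfield_adjoin_Rats complex_subfield_adjoin_Rats]
    unfolding generate_nonisomorphic_fields_def by blast+
qed

lemma irreducible_instances:
  "irreducible [:of_int 2, 0, of_int (- 4), 0, 1 :: rat:]"
  "irreducible [:of_int 2, 0, of_int 4, 0, 1 :: rat:]"
  "irreducible [:of_int 5, 0, of_int (- 5), 0, 1 :: rat:]"
proof -
  \<comment> \<open>The numbers 2, 8 and 5 are the values of \<open>d\<close> and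
    \<open>b^2 - 4 d\<close> for the three polynomials.\<close>
  have "r\<^sup>2 \<noteq> of_int 2" "r\<^sup>2 \<noteq> of_int 8" "r\<^sup>2 \<noteq> of_int 5" for r :: rat
    using not_rational_square[of 1 2] not_rational_square[of 2 8] not_rational_square[of 2 5]
    by (simp_all add: power2_eq_square)
  thus "irreducible [:of_int 2, 0, of_int (- 4), 0, 1 :: rat:]"
    "irreducible [:of_int 2, 0, of_int 4, 0, 1 :: rat:]"
    "irreducible [:of_int 5, 0, of_int (- 5), 0, 1 :: rat:]"
    by (intro irreducible_biquadratic; simp)+
qed

text \<open>The second field contains \<open>\<surd>5 = 2 \<theta>\<^sup>2 - 5\<close>, the first does not.\<close>

lemma generate_nonisomorphic_fields_real_real:
  "generate_nonisomorphic_fields [:2, 0, -4, 0, 1:] [:5, 0, -5, 0, 1:]"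
  unfolding generate_nonisomorphic_fields_def
proof (intro ballI notI)
  fix \<alpha> \<theta>
  assume \<alpha>: "\<alpha> \<in> int_poly_roots [:2, 0, -4, 0, 1:]" and \<theta>: "\<theta> \<in> int_poly_roots [:5, 0, -5, 0, 1:]"
    and iso: "complex_subring (adjoin_Rats {\<alpha>}) \<simeq> complex_subring (adjoin_Rats {\<theta>})"
  let ?p = "[:-5, 0, 1 :: rat:]"
  have p: "rpoly ?p x = x\<^sup>2 - 5" for x by (simp add: hom_distribs power2_eq_square)
  interpret biquadratic "-4" 2 \<alpha>
    using \<alpha> irreducible_instances(1) unfolding int_poly_roots_biquadratic by unfold_locales
  note D = complex_subfieldD[OF complex_subfield_adjoin_Rats[of "{\<theta>}"]]
  have "\<theta> \<in> adjoin_Rats {\<theta>}" using adjoin_Rats_incl by blast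
  hence "2 * \<theta>\<^sup>2 - 5 \<in> adjoin_Rats {\<theta>}"
    using D(6)[OF D(3)[OF D(1) D(7)] D(1), of 2 \<theta> 5 2] by simp
  moreover have "(2 * \<theta>\<^sup>2 - 5)\<^sup>2 - 5 = 4 * (\<theta> ^ 4 + of_int (- 5) * \<theta> ^ 2 + of_int 5)"
    by (simp add: algebra_simps power2_eq_square power4_eq_xxxx)
  hence "rpoly ?p (2 * \<theta>\<^sup>2 - 5) = 0"
    using \<theta> unfolding int_poly_roots_biquadratic p by (metis mult_zero_right)
  ultimately have "\<exists>x\<in>adjoin_Rats {\<alpha>}. rpoly ?p x = 0"
    using ring_iso_root_iff[OF complex_subfield_adjoin_Rats complex_subfield_adjoin_Rats iso] by blast
  then obtain x where x: "x \<in> adjoin_Rats {\<alpha>}" "rpoly ?p x = 0" by blast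
  hence "x\<^sup>2 = of_rat 5" unfolding p by simp
  \<comment> \<open>Here \<open>d = 2\<close>, \<open>c = 5\<close> and
    \<open>c (b^2 - 4 d) = 5 * 8 = 40\<close>.\<close>
  from square_root_in_adjoin[OF x(1) this] obtain r :: rat
    where "r\<^sup>2 = of_int 2 \<or> r\<^sup>2 = of_int 5 \<or> r\<^sup>2 = of_int 40" by auto
  thus False
    using not_rational_square[of 1 2 r] not_rational_square[of 2 5 r] not_rational_square[of 6 40 r]
    by simp
qed

section \<open>Rings of integers\<close>

lemma algebraic_int_of_rat:
  assumes "algebraic_int (of_rat x :: complex)"
  shows "x \<in> \<int>"
proof -
  have "of_rat x \<in> (\<int> :: complex set)" using rational_algebraic_int_is_int[OF assms] by simp
  then obtain n where "of_rat x = (of_int n :: complex)" by (auto elim: Ints_cases)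
  hence "of_rat x = (of_rat (of_int n) :: complex)" by simp
  hence "x = of_int n" by (simp only: of_rat_eq_iff)
  thus ?thesis by simp
qed

section \<open>Congruences that force integrality\<close>

lemma even_if_square_eq_double:
  fixes x y :: int
  assumes "x\<^sup>2 = 2 * y"
  shows "even x"
  using assms by (metis dvd_triv_left even_power)

text \<open>The hypotheses are the coordinates of a relative norm cleared of denominators. Reading
  them modulo 2 makes \<open>c0\<close>, \<open>c1\<close>, \<open>a0\<close> and \<open>a2\<close>
  even in this order, and finally the half of \<open>c0\<close>.\<close>

lemma parity_conductor_2:
  fixes a0 a2 c0 c1 n0 n1 e :: int
  assumes n0: "4 * n0 = a0\<^sup>2 - 2 * a2\<^sup>2 + 2 * c0 * c1 + 2 * e * c0\<^sup>2"
    and n1: "8 * n1 = 4 * a0 * a2 - 8 * e * a2\<^sup>2 - 2 * c1\<^sup>2 + c0\<^sup>2"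
  shows "even a0 \<and> even a2 \<and> even c1 \<and> 4 dvd c0"
proof -
  have "c0\<^sup>2 = 2 * (4 * n1 - 2 * a0 * a2 + 4 * e * a2\<^sup>2 + c1\<^sup>2)" using n1 by (simp add: algebra_simps)
  hence "even c0" by (rule even_if_square_eq_double)
  then obtain c where c: "c0 = 2 * c" by blast
  have "c1\<^sup>2 = 2 * (a0 * a2 - 2 * e * a2\<^sup>2 + c\<^sup>2 - 2 * n1)"
    using n1 by (simp add: c power_mult_distrib algebra_simps)
  hence "even c1" by (rule even_if_square_eq_double)
  then obtain k where k: "c1 = 2 * k" by blast
  have "a0\<^sup>2 = 2 * (2 * n0 + a2\<^sup>2 - 4 * c * k - 4 * e * c\<^sup>2)"
    using n0 by (simp add: c k power_mult_distrib algebra_simps)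
  hence "even a0" by (rule even_if_square_eq_double)
  then obtain u where u: "a0 = 2 * u" by blast
  have "a2\<^sup>2 = 2 * (u\<^sup>2 + 2 * c * k + 2 * e * c\<^sup>2 - n0)"
    using n0 by (simp add: c k u power_mult_distrib algebra_simps)
  hence "even a2" by (rule even_if_square_eq_double)
  have "c\<^sup>2 = 2 * (n1 - u * a2 + e * a2\<^sup>2 + k\<^sup>2)"
    using n1 by (simp add: c k u power_mult_distrib algebra_simps)
  hence "even c" by (rule even_if_square_eq_double)
  with \<open>even a0\<close> \<open>even a2\<close> \<open>even c1\<close> show ?thesis by (auto simp: c)
qed

text \<open>The second equation gives \<open>c0 = 5 * c\<close>. Modulo 2, the parities of
  \<open>a2\<close> and \<open>c\<close> determine those of \<open>a0\<close> and \<open>c1\<close>;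
  the three patterns other than all even fail modulo 4.\<close>

lemma parity_conductor_1:
  fixes a0 a2 c0 c1 n0 n1 :: int
  assumes n0: "4 * n0 = a0\<^sup>2 - 5 * a2\<^sup>2 + 2 * c0 * c1 - c0\<^sup>2"
    and n1: "20 * n1 = 10 * a0 * a2 + 25 * a2\<^sup>2 - 5 * c1\<^sup>2 + c0\<^sup>2"
  shows "even a0 \<and> even a2 \<and> even c1 \<and> 10 dvd c0"
proof -
  have "c0\<^sup>2 = 5 * (4 * n1 - 2 * a0 * a2 - 5 * a2\<^sup>2 + c1\<^sup>2)" using n1 by (simp add: algebra_simps)
  hence "5 dvd c0\<^sup>2" by (metis dvd_triv_left)
  hence "5 dvd c0" by (simp add: prime_dvd_power_iff)
  then obtain c where c: "c0 = 5 * c" by blast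
  have m0: "4 * n0 = a0\<^sup>2 - 5 * a2\<^sup>2 + 10 * c * c1 - 25 * c\<^sup>2"
    using n0 by (simp add: c power_mult_distrib)
  have m1: "4 * n1 = 2 * a0 * a2 + 5 * a2\<^sup>2 - c1\<^sup>2 + 5 * c\<^sup>2"
    using n1 by (simp add: c power_mult_distrib)
  have "even (a0\<^sup>2 - 5 * a2\<^sup>2 + 10 * c * c1 - 25 * c\<^sup>2)"
    unfolding m0[symmetric] by simp
  hence e0: "even a0 \<longleftrightarrow> (even a2 \<longleftrightarrow> even c)" by auto
  have "even (2 * a0 * a2 + 5 * a2\<^sup>2 - c1\<^sup>2 + 5 * c\<^sup>2)"
    unfolding m1[symmetric] by simp
  hence e1: "even c1 \<longleftrightarrow> (even a2 \<longleftrightarrow> even c)" by auto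
  have no: False if "4 * z = 2" for z :: int using that by presburger
  have "even c \<and> even a2"
  proof (rule ccontr)
    assume "\<not> (even c \<and> even a2)"
    then consider "odd c" "odd c1" "odd a0" "even a2" | "odd c" "even c1" "even a0" "odd a2"
      | "even c" "odd c1" "odd a0" "odd a2" using e0 e1 by blast
    thus False
    proof cases
      case 1
      then obtain k w u v where "c = 2 * k + 1" "c1 = 2 * w + 1" "a0 = 2 * u + 1" "a2 = 2 * v"
        by (meson oddE evenE)
      hence "4 * (u\<^sup>2 + u - 5 * v\<^sup>2 + 10 * k * w + 5 * k + 5 * w - 25 * k\<^sup>2 - 25 * k - 3 - n0) = 2"
        using m0 by (simp add: power2_eq_square algebra_simps)
      thus False by (rule no)
    next
      case 2
      then obtain k w u v where "c = 2 * k + 1" "c1 = 2 * w" "a0 = 2 * u" "a2 = 2 * v + 1"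
        by (meson oddE evenE)
      hence "4 * (u\<^sup>2 - 5 * v\<^sup>2 - 5 * v + 10 * k * w + 5 * w - 25 * k\<^sup>2 - 25 * k - 8 - n0) = -2"
        using m0 by (simp add: power2_eq_square algebra_simps)
      thus False by presburger
    next
      case 3
      then obtain k w u v where "c = 2 * k" "c1 = 2 * w + 1" "a0 = 2 * u + 1" "a2 = 2 * v + 1"
        by (meson oddE evenE)
      hence "4 * (2 * u * v + u + v + 5 * v\<^sup>2 + 5 * v - w\<^sup>2 - w + 5 * k\<^sup>2 + 1 - n1) = -2"
        using m1 by (simp add: power2_eq_square algebra_simps)
      thus False by presburger
    qed
  qed
  thus ?thesis using e0 e1 by (auto simp: c)
qed

text \<open>For \<open>b = 4 * e\<close> and \<open>d = 2\<close>, the trace \<open>t\<close> and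
  norm \<open>n\<close> of \<open>q0 + q1 \<theta>^2\<close> satisfy
  \<open>t^2 - 4 n = 8 q1^2\<close>. Thus \<open>4 * q1\<close> is an integer up to sign equal to
  \<open>s\<close>, and successive halving shows that 4 divides it.\<close>

lemma quadratic_integers_conductor_2:
  fixes q0 q1 :: rat and e :: int
  assumes tr: "2 * q0 - 4 * of_int e * q1 \<in> \<int>"
    and nm: "q0\<^sup>2 - 4 * of_int e * q0 * q1 + 2 * q1\<^sup>2 \<in> \<int>" and e: "e\<^sup>2 = 1"
  shows "q0 \<in> \<int> \<and> q1 \<in> \<int>"
proof -
  obtain t n where t: "2 * q0 - 4 * of_int e * q1 = of_int t"
    and n: "q0\<^sup>2 - 4 * of_int e * q0 * q1 + 2 * q1\<^sup>2 = of_int n"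
    using tr nm by (auto elim!: Ints_cases)
  have e': "of_int e * of_int e = (1 :: rat)" using e by (metis of_int_1 of_int_mult power2_eq_square)
  have "(of_int t)\<^sup>2 - 4 * of_int n = 8 * q1\<^sup>2 * (2 * (of_int e * of_int e) - 1)"
    unfolding t[symmetric] n[symmetric] by (simp add: power2_eq_square algebra_simps)
  hence tn: "8 * q1\<^sup>2 = of_int (t\<^sup>2 - 4 * n)" by (simp add: e')
  hence "(4 * q1)\<^sup>2 = of_int (2 * (t\<^sup>2 - 4 * n))" by (simp add: power2_eq_square)
  then obtain s where s: "2 * (t\<^sup>2 - 4 * n) = s\<^sup>2" and "(4 * q1)\<^sup>2 = (of_int s)\<^sup>2"
    using rational_square_imp_square by (metis of_int_power)
  hence q1: "4 * q1 = of_int s \<or> 4 * q1 = of_int (- s)" by (simp only: power2_eq_iff of_int_minus)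
  have "even s" using s even_if_square_eq_double by metis
  then obtain r where r: "s = 2 * r" by blast
  have "t\<^sup>2 = 2 * (2 * n + r\<^sup>2)" using s by (simp add: r power2_eq_square)
  hence "even t" by (rule even_if_square_eq_double)
  then obtain u where u: "t = 2 * u" by blast
  have "r\<^sup>2 = 2 * (u\<^sup>2 - n)" using s by (simp add: r u power2_eq_square)
  hence "even r" by (rule even_if_square_eq_double)
  then obtain v where v: "r = 2 * v" by blast
  have "q1 = of_int v \<or> q1 = of_int (- v)" using q1 by (auto simp: r v)
  then obtain w where w: "q1 = of_int w" by blast
  have "q0 = of_int (u + 2 * e * w)" using t by (simp add: u w)
  thus ?thesis using w by simp
qed

text \<open>For \<open>b = -5\<close> and \<open>d = 5\<close>, trace and norm satisfy
  \<open>t^2 - 4 n = 5 q1^2\<close>. This makes \<open>q1\<close> an integer, and \<open>t\<close>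
  has the parity of \<open>5 * q1\<close>, so \<open>q0\<close> is an integer too.\<close>

lemma quadratic_integers_conductor_1:
  fixes q0 q1 :: rat
  assumes tr: "2 * q0 + 5 * q1 \<in> \<int>" and nm: "q0\<^sup>2 + 5 * q0 * q1 + 5 * q1\<^sup>2 \<in> \<int>"
  shows "q0 \<in> \<int> \<and> q1 \<in> \<int>"
proof -
  obtain t n where t: "2 * q0 + 5 * q1 = of_int t" and n: "q0\<^sup>2 + 5 * q0 * q1 + 5 * q1\<^sup>2 = of_int n"
    using tr nm by (auto elim!: Ints_cases)
  have tn: "5 * q1\<^sup>2 = of_int (t\<^sup>2 - 4 * n)"
    unfolding of_int_diff of_int_mult of_int_power t[symmetric] n[symmetric]
    by (simp add: t[symmetric] n[symmetric] power2_eq_square algebra_simps)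
  hence "(5 * q1)\<^sup>2 = of_int (5 * (t\<^sup>2 - 4 * n))" by (simp add: power2_eq_square)
  then obtain s where s: "5 * (t\<^sup>2 - 4 * n) = s\<^sup>2" and "(5 * q1)\<^sup>2 = (of_int s)\<^sup>2"
    using rational_square_imp_square by (metis of_int_power)
  hence q1: "5 * q1 = of_int s \<or> 5 * q1 = of_int (- s)" by (simp only: power2_eq_iff of_int_minus)
  have "5 dvd s\<^sup>2" using s by (metis dvd_triv_left)
  hence "5 dvd s" by (simp add: prime_dvd_power_iff)
  then obtain v where v: "s = 5 * v" by blast
  have "q1 = of_int v \<or> q1 = of_int (- v)" using q1 by (auto simp: v)
  then obtain w where w: "q1 = of_int w" by blast
  have "of_int (5 * w\<^sup>2) = (of_int (t\<^sup>2 - 4 * n) :: rat)" using tn by (simp add: w)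
  hence "t\<^sup>2 - 4 * n = 5 * w\<^sup>2" by (simp only: of_int_eq_iff)
  hence "even (t\<^sup>2 - 4 * n) \<longleftrightarrow> even (5 * w\<^sup>2)" by simp
  hence "even (t - 5 * w)" by auto
  then obtain z where z: "t - 5 * w = 2 * z" by blast
  have "2 * q0 = of_int (t - 5 * w)" using t by (simp add: w)
  hence "q0 = of_int z" unfolding z by simp
  thus ?thesis using w by simp
qed

section \<open>Coordinates of algebraic integers\<close>

context biquadratic
begin

text \<open>Replacing \<open>\<theta>\<close> by the conjugate root \<open>\<phi>\<close> preserves
  integrality. The sum and product of the two values are rational algebraic integers, hence
  integers.\<close>

lemma trace_norm_integral:
  assumes int: "algebraic_int (rpoly [:q0, 0, q1, 0:] \<theta>)"
  shows "2 * q0 - of_int b * q1 \<in> \<int> \<and> q0\<^sup>2 - of_int b * q0 * q1 + of_int d * q1\<^sup>2 \<in> \<int>"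
proof -
  define \<phi> where "\<phi> = csqrt (- of_int b - \<theta>\<^sup>2)"
  have \<phi>2: "\<phi>\<^sup>2 = - of_int b - \<theta>\<^sup>2" by (simp add: \<phi>_def)
  have "\<phi> ^ 4 = (\<phi>\<^sup>2)\<^sup>2" by (simp add: power2_eq_square power4_eq_xxxx)
  hence "\<phi> ^ 4 + of_int b * \<phi>\<^sup>2 + of_int d = \<theta> ^ 4 + of_int b * \<theta>\<^sup>2 + of_int d"
    unfolding \<phi>2 by (simp add: algebra_simps power2_eq_square power4_eq_xxxx)
  hence "rpoly minpoly \<phi> = 0" using root unfolding rpoly_biquadratic by simp
  hence int': "algebraic_int (rpoly [:q0, 0, q1, 0:] \<phi>)"
    using algebraic_int_conjugate[OF irred rpoly_minpoly _ int] by blast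
  have "rpoly [:q0, 0, q1, 0:] \<theta> + rpoly [:q0, 0, q1, 0:] \<phi> = of_rat (2 * q0 - of_int b * q1)"
    unfolding rpoly_cubic \<phi>2 by (simp add: of_rat_mult of_rat_diff algebra_simps)
  moreover have "rpoly [:q0, 0, q1, 0:] \<theta> * rpoly [:q0, 0, q1, 0:] \<phi> =
      of_rat (q0\<^sup>2 - of_int b * q0 * q1 + of_int d * q1\<^sup>2)"
  proof -
    have "rpoly [:q0, 0, q1, 0:] \<theta> * rpoly [:q0, 0, q1, 0:] \<phi> =
      of_rat (q0\<^sup>2 - of_int b * q0 * q1 + of_int d * q1\<^sup>2) -
      of_rat q1 ^ 2 * (\<theta> ^ 4 + of_int b * \<theta>\<^sup>2 + of_int d)"
      unfolding rpoly_cubic \<phi>2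
      by (simp add: of_rat_add of_rat_mult of_rat_diff of_rat_power algebra_simps
          power2_eq_square power4_eq_xxxx)
    thus ?thesis using root by simp
  qed
  ultimately show ?thesis
    using algebraic_int_add[OF int int'] algebraic_int_mult[OF int int'] algebraic_int_of_rat
    by metis
qed

text \<open>
  With \<open>x'\<close> the conjugate of \<open>x\<close> under \<open>\<theta> \<mapsto> - \<theta>\<close>, the three pairs are the coordinates of
  \<open>x + x'\<close>, \<open>\<theta> (x - x')\<close> and \<open>x x'\<close> in the quadratic subfield.
\<close>

lemma relative_trace_norm_integral:
  assumes quad: "\<forall>q0 q1. algebraic_int (rpoly [:q0, 0, q1, 0:] \<theta>) \<longrightarrow> q0 \<in> \<int> \<and> q1 \<in> \<int>"
    and int: "algebraic_int (rpoly [:p0, p1, p2, p3:] \<theta>)"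
  shows "2 * p0 \<in> \<int>" "2 * p2 \<in> \<int>" "2 * of_int d * p3 \<in> \<int>" "2 * p1 - 2 * of_int b * p3 \<in> \<int>"
    "p0\<^sup>2 - of_int d * p2\<^sup>2 + 2 * of_int d * p1 * p3 - of_int (b * d) * p3\<^sup>2 \<in> \<int>"
    "2 * p0 * p2 - of_int b * p2\<^sup>2 - p1\<^sup>2 + 2 * of_int b * p1 * p3 - of_int (b\<^sup>2 - d) * p3\<^sup>2 \<in> \<int>"
proof -
  let ?x = "rpoly [:p0, p1, p2, p3:] \<theta>" and ?x' = "rpoly [:p0, p1, p2, p3:] (- \<theta>)"
  have "rpoly minpoly (- \<theta>) = 0" using root unfolding rpoly_biquadratic by simp
  hence int': "algebraic_int ?x'"
    using algebraic_int_conjugate[OF irred rpoly_minpoly _ int] by blast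
  have "?x + ?x' = rpoly [:2 * p0, 0, 2 * p2, 0:] \<theta>"
    unfolding rpoly_cubic by (simp add: of_rat_mult)
  with algebraic_int_add[OF int int'] quad show "2 * p0 \<in> \<int>" "2 * p2 \<in> \<int>" by metis+
  \<comment> \<open>The difference is odd in \<open>\<theta>\<close>; the extra factor
    \<open>\<theta>\<close> brings it into the quadratic subfield.\<close>
  have "\<theta> * (?x - ?x') = rpoly [:- 2 * of_int d * p3, 0, 2 * p1 - 2 * of_int b * p3, 0:] \<theta> +
      2 * of_rat p3 * (\<theta> ^ 4 + of_int b * \<theta>\<^sup>2 + of_int d)"
    unfolding rpoly_cubic
    by (simp add: of_rat_mult of_rat_diff of_rat_minus algebra_simps power2_eq_square
        power3_eq_cube power4_eq_xxxx)
  hence "\<theta> * (?x - ?x') = rpoly [:- 2 * of_int d * p3, 0, 2 * p1 - 2 * of_int b * p3, 0:] \<theta>"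
    using root by simp
  with algebraic_int_mult[OF algebraic_int_gen algebraic_int_diff[OF int int']] quad
  have "- 2 * of_int d * p3 \<in> \<int> \<and> 2 * p1 - 2 * of_int b * p3 \<in> \<int>" by metis
  thus "2 * of_int d * p3 \<in> \<int>" "2 * p1 - 2 * of_int b * p3 \<in> \<int>"
    using Ints_minus[of "- 2 * of_int d * p3"] by simp_all
  define q0 q1 q2 q3 B D :: complex where q: "q0 = of_rat p0" "q1 = of_rat p1" "q2 = of_rat p2"
    "q3 = of_rat p3" "B = of_int b" "D = of_int d"
  have "(q0 + q1 * \<theta> + q2 * \<theta>\<^sup>2 + q3 * \<theta> ^ 3) * (q0 - q1 * \<theta> + q2 * \<theta>\<^sup>2 - q3 * \<theta> ^ 3) =
      (q0\<^sup>2 - D * q2\<^sup>2 + 2 * D * q1 * q3 - B * D * q3\<^sup>2) +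
      (2 * q0 * q2 - B * q2\<^sup>2 - q1\<^sup>2 + 2 * B * q1 * q3 - (B\<^sup>2 - D) * q3\<^sup>2) * \<theta>\<^sup>2 +
      (q2\<^sup>2 - 2 * q1 * q3 - q3\<^sup>2 * (\<theta>\<^sup>2 - B)) * (\<theta> ^ 4 + B * \<theta>\<^sup>2 + D)"
    by (simp add: algebra_simps power2_eq_square power3_eq_cube power4_eq_xxxx)
  also have "\<theta> ^ 4 + B * \<theta>\<^sup>2 + D = 0" using root by (simp add: q)
  finally have "?x * ?x' = rpoly [:p0\<^sup>2 - of_int d * p2\<^sup>2 + 2 * of_int d * p1 * p3 - of_int (b * d) * p3\<^sup>2, 0,
      2 * p0 * p2 - of_int b * p2\<^sup>2 - p1\<^sup>2 + 2 * of_int b * p1 * p3 - of_int (b\<^sup>2 - d) * p3\<^sup>2, 0:] \<theta>"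
    unfolding rpoly_cubic
    by (simp add: of_rat_add of_rat_mult of_rat_diff of_rat_power q)
  with algebraic_int_mult[OF int int'] quad
  show "p0\<^sup>2 - of_int d * p2\<^sup>2 + 2 * of_int d * p1 * p3 - of_int (b * d) * p3\<^sup>2 \<in> \<int>"
    "2 * p0 * p2 - of_int b * p2\<^sup>2 - p1\<^sup>2 + 2 * of_int b * p1 * p3 - of_int (b\<^sup>2 - d) * p3\<^sup>2 \<in> \<int>"
    by metis+
qed

text \<open>The sign \<open>e\<close> treats \<open>b = 4\<close> and \<open>b = -4\<close> at once.
  The integers \<open>a0\<close>, \<open>a2\<close>, \<open>c0\<close>, \<open>c1\<close> come from
  the relative trace and from \<open>\<theta> (x - x')\<close>; the relative norm supplies the
  congruences of \<open>parity_conductor_2\<close>.\<close>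

lemma coeffs_integral_conductor_2:
  assumes bd: "b = 4 * e" "e\<^sup>2 = 1" "d = 2"
    and int: "algebraic_int (rpoly [:p0, p1, p2, p3:] \<theta>)"
  shows "p0 \<in> \<int> \<and> p1 \<in> \<int> \<and> p2 \<in> \<int> \<and> p3 \<in> \<int>"
proof -
  have "q0 \<in> \<int> \<and> q1 \<in> \<int>" if "algebraic_int (rpoly [:q0, 0, q1, 0:] \<theta>)" for q0 q1
    using trace_norm_integral[OF that] bd(2) unfolding bd(1,3)
    by (intro quadratic_integers_conductor_2[of q0 e q1]) simp_all
  hence "\<forall>q0 q1. algebraic_int (rpoly [:q0, 0, q1, 0:] \<theta>) \<longrightarrow> q0 \<in> \<int> \<and> q1 \<in> \<int>"
    by blast
  note R = relative_trace_norm_integral[OF this int]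
  define E :: rat where "E = of_int e"
  have E: "E * E = 1" using bd(2) unfolding E_def by (metis of_int_1 of_int_mult power2_eq_square)
  from R(1) obtain a0 where a0: "2 * p0 = of_int a0" by (elim Ints_cases)
  from R(2) obtain a2 where a2: "2 * p2 = of_int a2" by (elim Ints_cases)
  have "4 * p3 \<in> \<int>" using R(3) by (simp add: bd(3))
  then obtain c0 where c0: "4 * p3 = of_int c0" by (elim Ints_cases)
  have "2 * p1 - 8 * E * p3 \<in> \<int>" using R(4) by (simp add: bd(1) E_def)
  then obtain c1 where c1: "2 * p1 - 8 * E * p3 = of_int c1" by (elim Ints_cases)
  have "p0\<^sup>2 - 2 * p2\<^sup>2 + 4 * p1 * p3 - 8 * E * p3\<^sup>2 \<in> \<int>"
    using R(5) by (simp add: bd(1,3) E_def mult_ac)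
  then obtain n0 where n0: "p0\<^sup>2 - 2 * p2\<^sup>2 + 4 * p1 * p3 - 8 * E * p3\<^sup>2 = of_int n0"
    by (elim Ints_cases)
  have "of_int (b\<^sup>2 - d) = 16 * (E * E) - 2" by (simp add: bd(1,3) E_def power2_eq_square)
  hence "2 * p0 * p2 - 4 * E * p2\<^sup>2 - p1\<^sup>2 + 8 * E * p1 * p3 - 14 * p3\<^sup>2 \<in> \<int>"
    using R(6) unfolding E by (simp add: bd(1,3) E_def mult_ac)
  then obtain n1 where n1: "2 * p0 * p2 - 4 * E * p2\<^sup>2 - p1\<^sup>2 + 8 * E * p1 * p3 - 14 * p3\<^sup>2 = of_int n1"
    by (elim Ints_cases)
  have p: "p0 = of_int a0 / 2" "p2 = of_int a2 / 2" "p3 = of_int c0 / 4"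
    "p1 = of_int c1 / 2 + E * of_int c0"
  proof -
    have "8 * E * p3 = 2 * (E * of_int c0)" unfolding c0[symmetric] by simp
    with a0 a2 c0 c1 show "p0 = of_int a0 / 2" "p2 = of_int a2 / 2" "p3 = of_int c0 / 4"
      "p1 = of_int c1 / 2 + E * of_int c0" by linarith+
  qed
  have "of_int (4 * n0) = 4 * (p0\<^sup>2 - 2 * p2\<^sup>2 + 4 * p1 * p3 - 8 * E * p3\<^sup>2)" by (simp add: n0)
  also have "\<dots> = of_int (a0\<^sup>2 - 2 * a2\<^sup>2 + 2 * c0 * c1 + 2 * e * c0\<^sup>2)"
    unfolding p by (simp add: field_simps power2_eq_square E_def)
  finally have n0': "4 * n0 = a0\<^sup>2 - 2 * a2\<^sup>2 + 2 * c0 * c1 + 2 * e * c0\<^sup>2" by (simp only: of_int_eq_iff)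
  have "of_int (8 * n1) = 8 * (2 * p0 * p2 - 4 * E * p2\<^sup>2 - p1\<^sup>2 + 8 * E * p1 * p3 - 14 * p3\<^sup>2)"
    by (simp add: n1)
  also have "\<dots> = 4 * of_int a0 * of_int a2 - 8 * E * (of_int a2)\<^sup>2 - 2 * (of_int c1)\<^sup>2
      + (8 * (E * E) - 7) * (of_int c0)\<^sup>2"
    unfolding p by (simp add: field_simps power2_eq_square)
  also have "\<dots> = of_int (4 * a0 * a2 - 8 * e * a2\<^sup>2 - 2 * c1\<^sup>2 + c0\<^sup>2)"
    unfolding E by (simp add: E_def)
  finally have n1': "8 * n1 = 4 * a0 * a2 - 8 * e * a2\<^sup>2 - 2 * c1\<^sup>2 + c0\<^sup>2" by (simp only: of_int_eq_iff)
  obtain k0 k2 k1 k3 where "a0 = 2 * k0" "a2 = 2 * k2" "c1 = 2 * k1" "c0 = 4 * k3"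
    using parity_conductor_2[OF n0' n1'] by (auto elim!: dvdE)
  thus ?thesis unfolding p E_def by simp
qed

text \<open>The same argument, with \<open>c0 = 10 * p3\<close> and
  \<open>c1 = 2 * p1 + 10 * p3\<close>; divisibility of \<open>c0\<close> by 10 is what makes
  \<open>p3\<close> integral.\<close>

lemma coeffs_integral_conductor_1:
  assumes bd: "b = - 5" "d = 5"
    and int: "algebraic_int (rpoly [:p0, p1, p2, p3:] \<theta>)"
  shows "p0 \<in> \<int> \<and> p1 \<in> \<int> \<and> p2 \<in> \<int> \<and> p3 \<in> \<int>"
proof -
  have "q0 \<in> \<int> \<and> q1 \<in> \<int>" if "algebraic_int (rpoly [:q0, 0, q1, 0:] \<theta>)" for q0 q1
    using trace_norm_integral[OF that] unfolding bd
    by (intro quadratic_integers_conductor_1[of q0 q1]) simp_all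
  hence "\<forall>q0 q1. algebraic_int (rpoly [:q0, 0, q1, 0:] \<theta>) \<longrightarrow> q0 \<in> \<int> \<and> q1 \<in> \<int>"
    by blast
  note R = relative_trace_norm_integral[OF this int]
  from R(1) obtain a0 where a0: "2 * p0 = of_int a0" by (elim Ints_cases)
  from R(2) obtain a2 where a2: "2 * p2 = of_int a2" by (elim Ints_cases)
  have "10 * p3 \<in> \<int>" using R(3) by (simp add: bd)
  then obtain c0 where c0: "10 * p3 = of_int c0" by (elim Ints_cases)
  have "2 * p1 + 10 * p3 \<in> \<int>" using R(4) by (simp add: bd)
  then obtain c1 where c1: "2 * p1 + 10 * p3 = of_int c1" by (elim Ints_cases)
  have "p0\<^sup>2 - 5 * p2\<^sup>2 + 10 * p1 * p3 + 25 * p3\<^sup>2 \<in> \<int>"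
    using R(5) by (simp add: bd)
  then obtain n0 where n0: "p0\<^sup>2 - 5 * p2\<^sup>2 + 10 * p1 * p3 + 25 * p3\<^sup>2 = of_int n0"
    by (elim Ints_cases)
  have "2 * p0 * p2 + 5 * p2\<^sup>2 - p1\<^sup>2 - 10 * p1 * p3 - 20 * p3\<^sup>2 \<in> \<int>"
    using R(6) by (simp add: bd)
  then obtain n1 where n1: "2 * p0 * p2 + 5 * p2\<^sup>2 - p1\<^sup>2 - 10 * p1 * p3 - 20 * p3\<^sup>2 = of_int n1"
    by (elim Ints_cases)
  have p: "p0 = of_int a0 / 2" "p2 = of_int a2 / 2" "p3 = of_int c0 / 10"
    "p1 = (of_int c1 - of_int c0) / 2"
    by (simp_all flip: a0 a2 c0 c1)
  have "of_int (4 * n0) = 4 * (p0\<^sup>2 - 5 * p2\<^sup>2 + 10 * p1 * p3 + 25 * p3\<^sup>2)" by (simp add: n0)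
  also have "\<dots> = of_int (a0\<^sup>2 - 5 * a2\<^sup>2 + 2 * c0 * c1 - c0\<^sup>2)"
    unfolding p by (simp add: field_simps power2_eq_square)
  finally have n0': "4 * n0 = a0\<^sup>2 - 5 * a2\<^sup>2 + 2 * c0 * c1 - c0\<^sup>2" by (simp only: of_int_eq_iff)
  have "of_int (20 * n1) = 20 * (2 * p0 * p2 + 5 * p2\<^sup>2 - p1\<^sup>2 - 10 * p1 * p3 - 20 * p3\<^sup>2)"
    by (simp add: n1)
  also have "\<dots> = of_int (10 * a0 * a2 + 25 * a2\<^sup>2 - 5 * c1\<^sup>2 + c0\<^sup>2)"
    unfolding p by (simp add: field_simps power2_eq_square)
  finally have n1': "20 * n1 = 10 * a0 * a2 + 25 * a2\<^sup>2 - 5 * c1\<^sup>2 + c0\<^sup>2" by (simp only: of_int_eq_iff)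
  obtain k0 k2 k1 k3 where "a0 = 2 * k0" "a2 = 2 * k2" "c1 = 2 * k1" "c0 = 10 * k3"
    using parity_conductor_1[OF n0' n1'] by (auto elim!: dvdE)
  thus ?thesis unfolding p by (simp add: diff_divide_distrib)
qed

lemma ring_of_integers_eq_if_coeffs_integral:
  assumes "\<And>p0 p1 p2 p3. algebraic_int (rpoly [:p0, p1, p2, p3:] \<theta>) \<Longrightarrow>
    p0 \<in> \<int> \<and> p1 \<in> \<int> \<and> p2 \<in> \<int> \<and> p3 \<in> \<int>"
  shows "ring_of_integers (adjoin_Rats {\<theta>}) = integral_cubics"
proof
  show "ring_of_integers (adjoin_Rats {\<theta>}) \<subseteq> integral_cubics"
  proof
    fix x assume x: "x \<in> ring_of_integers (adjoin_Rats {\<theta>})"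
    then obtain p0 p1 p2 p3 where p: "x = rpoly [:p0, p1, p2, p3:] \<theta>"
      using adjoin_cubicE unfolding ring_of_integers_def by blast
    have "algebraic_int (rpoly [:p0, p1, p2, p3:] \<theta>)"
      using x unfolding ring_of_integers_def p by blast
    from assms[OF this] show "x \<in> integral_cubics"
      unfolding p by (simp only: cubic_in_integral_cubics_iff)
  qed
  have int: "algebraic_int (of_int n :: complex)" for n by (rule int_imp_algebraic_int) simp
  have "algebraic_int (rpoly [:of_int n0, of_int n1, of_int n2, of_int n3:] \<theta>)" for n0 n1 n2 n3
    unfolding rpoly_cubic power2_eq_square power3_eq_cube of_rat_of_int_eq
    by (intro algebraic_int_add algebraic_int_mult algebraic_int_gen int)
  thus "integral_cubics \<subseteq> ring_of_integers (adjoin_Rats {\<theta>})"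
    unfolding integral_cubics_def ring_of_integers_def using cubic_in_adjoin by blast
qed

end

section \<open>The three trinomials are monogenic and cyclic\<close>

lemma monogenic_instances:
  assumes "(b, d) \<in> {(-4, 2), (4, 2), (-5, 5)}"
  shows "monogenic [:d, 0, b, 0, 1:]"
  unfolding monogenic_biquadratic_iff
proof (intro conjI allI impI)
  show irred: "irreducible [:of_int d, 0, of_int b, 0, 1 :: rat:]"
    using assms irreducible_instances by auto
  fix z :: complex assume "z ^ 4 + of_int b * z\<^sup>2 + of_int d = 0"
  then interpret biquadratic b d z using irred by unfold_locales
  show "ring_of_integers (adjoin_Rats {z}) = integral_cubics"
    using assms coeffs_integral_conductor_2[of 1] coeffs_integral_conductor_2[of "- 1"]
      coeffs_integral_conductor_1
    by (intro ring_of_integers_eq_if_coeffs_integral) auto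
qed

text \<open>The second pair of roots is \<open>\<theta>\<^sup>3 - 3 \<theta>\<close> up to sign, or \<open>- \<theta>\<^sup>3 - 3 \<theta>\<close> if \<open>b = 4\<close>.\<close>

lemma cyclic_instances:
  assumes bd: "(b, d) \<in> {(-4, 2), (4, 2), (-5, 5)}"
  shows "galois_group [:d, 0, b, 0, 1:] \<cong> integer_mod_group 4"
proof -
  have irred: "irreducible [:of_int d, 0, of_int b, 0, 1 :: rat:]"
    using bd irreducible_instances by auto
  have "\<not> constant (poly [:of_int d, 0, of_int b, 0, 1 :: complex:])" by (simp add: constant_degree)
  then obtain \<theta> :: complex where "poly [:of_int d, 0, of_int b, 0, 1:] \<theta> = 0"
    using fundamental_theorem_of_algebra by blast
  hence root: "\<theta> ^ 4 + of_int b * \<theta>\<^sup>2 + of_int d = 0"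
    by (simp add: algebra_simps power2_eq_square power4_eq_xxxx)
  interpret biquadratic b d \<theta> using irred root by unfold_locales
  define e :: rat where "e = (if b = 4 then -1 else 1)"
  define \<epsilon> :: complex where "\<epsilon> = (if b = 4 then -1 else 1)"
  have q: "rpoly [:0, -3, 0, e:] x = \<epsilon> * x ^ 3 - 3 * x" for x
    unfolding rpoly_cubic by (simp add: e_def \<epsilon>_def)
  \<comment> \<open>For \<open>b < 0\<close> the roots have the form 2 cos t, and this is the
    formula for 2 cos 3t; for \<open>b = 4\<close> they are such numbers times the imaginary
    unit.\<close>
  define \<phi> where "\<phi> = \<epsilon> * \<theta> ^ 3 - 3 * \<theta>"
  \<comment> \<open>The multiples of \<open>r\<close> below are quotients by the quartic: with them
    the identities hold by expansion, and \<open>r = 0\<close> then removes them.\<close>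
  define r where "r = \<theta> ^ 4 + of_int b * \<theta>\<^sup>2 + of_int d"
  have r: "r = 0" unfolding r_def by (rule root)
  show ?thesis
  proof (rule cyclic_if_gen_quartic_automorphism)
    show "\<phi> = rpoly [:0, -3, 0, e:] \<theta>" unfolding q \<phi>_def ..
    have "\<phi>\<^sup>2 = - of_int b - \<theta>\<^sup>2 + r * (\<theta>\<^sup>2 - (if b = 4 then -2 else if b = -4 then 2 else 1))"
      using bd by (auto simp: \<phi>_def r_def \<epsilon>_def algebra_simps power2_eq_square power3_eq_cube power4_eq_xxxx)
    thus \<phi>2: "\<phi>\<^sup>2 = - of_int b - \<theta>\<^sup>2" by (simp add: r)
    have "\<epsilon> * \<phi> ^ 3 - 3 * \<phi> = (\<epsilon> * \<phi>\<^sup>2 - 3) * \<phi>" by (simp add: algebra_simps power2_eq_square power3_eq_cube)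
    also have "\<dots> = - \<theta> + r * (- \<theta>)"
      unfolding \<phi>2 using bd by (auto simp: \<phi>_def r_def \<epsilon>_def algebra_simps power2_eq_square power3_eq_cube power4_eq_xxxx)
    finally show "rpoly [:0, -3, 0, e:] \<phi> = - \<theta>" unfolding q by (simp add: r)
  qed
qed

theorem theorem1p1:
  fixes b d :: int and f :: "int poly"
  assumes "f = [:d, 0, b, 0, 1:]"
  shows "(monogenic f \<and> galois_group f \<cong> integer_mod_group 4 \<longleftrightarrow>
            f \<in> {[:2, 0, -4, 0, 1:], [:2, 0, 4, 0, 1:], [:5, 0, -5, 0, 1:]}) \<and>
         generate_nonisomorphic_fields [:2, 0, -4, 0, 1:] [:2, 0, 4, 0, 1:] \<and>
         generate_nonisomorphic_fields [:2, 0, -4, 0, 1:] [:5, 0, -5, 0, 1:] \<and>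
         generate_nonisomorphic_fields [:2, 0, 4, 0, 1:] [:5, 0, -5, 0, 1:]"
proof -
  have "f \<in> {[:2, 0, -4, 0, 1:], [:2, 0, 4, 0, 1:], [:5, 0, -5, 0, 1:]} \<longleftrightarrow>
      (b, d) \<in> {(-4, 2), (4, 2), (-5, 5)}"
    unfolding assms by auto
  thus ?thesis
    using monogenic_cyclic_imp monogenic_instances cyclic_instances
      generate_nonisomorphic_fields_real_imaginary(1)[of "-4" 2]
      generate_nonisomorphic_fields_real_imaginary(2)[of "-5" 5]
      generate_nonisomorphic_fields_real_real
    unfolding assms by auto
qed

end
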